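(* Let $r,d\in\mathbb{N}$ with $r,d\ge 1$, let $a<b$, $D>0$, let $M\subset\mathbb{R}^d$ be a nonempty open set and let $\eta\in M$. Consider the initial-value problem $z'(t)=f(z(t))$, $t\in[a,b]$, $z(a)=\eta$, with $f\in F_{r,d}$. (i) For the class of all linear nonadaptive information, we have $$\mathrm{comp}^{\mathrm{nonad}}(\varepsilon,F_{r,d})=\Omega\left(\left(1/\varepsilon\right)^{\max\{(d-1)/r,\ d/(r+1)\}}\right)\quad\text{as }\varepsilon\to0 .$$ (ii) Let $\{k(n)\}_{n=1}^\infty\subset\mathbb{N}$ be a sequence for which there exist $\alpha>0$ and $n_0\in\mathbb{N}$ such that $k(n)\le\alpha n^{1-1/d}$ for all $n\ge n_0$. For the class of nonadaptive information operators of the form $$N_n(f)=[\bar L_1(f),\ldots,\bar L_{n-k}(f),L_1(f),\ldots,L_k(f)]^T,\qquad k=k(n),\quad n\ge k+1,$$ where $\bar L_1,\ldots,\bar L_{n-k}$ are arbitrary standard information functionals and $L_1,\ldots,L_k$ are arbitrary linear functionals, we have $$\mathrm{comp}^{\mathrm{nonad}}(\varepsilon,F_{r,d})=\Omega\left(\left(1/\varepsilon\right)^{d/r}\right)\quad\text{as }\varepsilon\to0 .$$ (The constant and the maximal value of $\varepsilon$ in this $\Omega$ notation depend on $\alpha$ and $n_0$.)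
   Context: Throughout, $\|\cdot\|$ is the maximum norm in $\mathbb{R}^d$, and $\mathbb{N}$ denotes the positive integers. The numbers $a<b$, the vector $\eta$, the set $M$, the number $D$, and $r,d$ are fixed; the asymptotic symbol $\Omega$ is meant as $\varepsilon\to0$, i.e. $g(\varepsilon)=\Omega(\gamma(\varepsilon))$ means that there are $C>0$ and $\varepsilon_0>0$ with $g(\varepsilon)\ge C\gamma(\varepsilon)$ for all $0<\varepsilon\le\varepsilon_0$. Function class: $$F_{r,d}=\{f:\mathbb{R}^d\to\mathbb{R}^d:\ f\in C^r(\mathbb{R}^d),\ f(y)=0\text{ for }y\notin M,\ |D^if^j(y)|\le D,\ y\in\mathbb{R}^d,\ i=0,1,\ldots,r,\ j=1,\ldots,d\},$$ where $D^if^j$ denotes any partial derivative of order $i$ of the $j$th component of $f=[f^1,\ldots,f^d]^T$. For $f\in F_{r,d}$, $z=z_f:[a,b]\to\mathbb{R}^d$ denotes the solution of $z'(t)=f(z(t))$, $t\in[a,b]$, $z(a)=\eta$. Information: for $n\in\mathbb{N}$, nonadaptive linear information is a vector $N_n(f)=[L_1(f),\ldots,L_n(f)]^T$, where $L_1,\ldots,L_n$ are linear functionals on the space of $C^r$ functions $f:\mathbb{R}^d\to\mathbb{R}^d$, chosen in advance, independently of $f$. A standard information functional is one of the form $L(f)=D^{k'}f^{i}(y)$, where $D^{k'}$ is some partial derivative of order $k'$, $0\le k'\le r$, $1\le i\le d$, $y\in\mathbb{R}^d$ (all fixed in advance). Algorithm and error: an algorithm is any function $\Phi_n$ which assigns to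 the vector $N_n(f)\in\mathbb{R}^n$ a function $l=\Phi_n(N_n(f)):[a,b]\to\mathbb{R}^d$. Its worst-case error is $$e(\Phi_n,N_n,F_{r,d})=\sup_{f\in F_{r,d}}\ \sup_{t\in[a,b]}\|z_f(t)-\Phi_n(N_n(f))(t)\| .$$ Complexity: for a given class of nonadaptive information operators, $$\mathrm{comp}^{\mathrm{nonad}}(\varepsilon,F_{r,d})=\min\{n\ge1:\ \text{there exist }N_n\text{ in the class and an algorithm }\Phi_n\text{ with }e(\Phi_n,N_n,F_{r,d})\le\varepsilon\},$$ with $\min\emptyset=+\infty$. *)

theory Defs
  imports "HOL-Analysis.Analysis"
begin

definition partial_deriv :: "'d::finite \<Rightarrow> (real^'d \<Rightarrow> real) \<Rightarrow> real^'d \<Rightarrow> real" where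
  "partial_deriv i g y = deriv (\<lambda>s. g (y + s *\<^sub>R axis i 1)) 0"

definition has_partial :: "'d::finite \<Rightarrow> (real^'d \<Rightarrow> real) \<Rightarrow> real^'d \<Rightarrow> bool" where
  "has_partial i g y \<longleftrightarrow> (\<lambda>s. g (y + s *\<^sub>R axis i 1)) field_differentiable at 0"

text \<open>A partial derivative of order \<open>k\<close> is given by a list of \<open>k\<close> coordinate directions; the
  head of the list is the direction of the last differentiation.\<close>

fun iter_partial :: "'d::finite list \<Rightarrow> (real^'d \<Rightarrow> real) \<Rightarrow> real^'d \<Rightarrow> real" where
  "iter_partial [] g = g"
| "iter_partial (i # is) g = partial_deriv i (iter_partial is g)"

definition C_scalar :: "nat \<Rightarrow> (real^'d::finite \<Rightarrow> real) set" where
  "C_scalar r = {g.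
     (\<forall>is i y. length is < r \<longrightarrow> has_partial i (iter_partial is g) y) \<and>
     (\<forall>is. length is \<le> r \<longrightarrow> continuous_on UNIV (iter_partial is g))}"

definition C_vector :: "nat \<Rightarrow> (real^'d::finite \<Rightarrow> real^'d) set" where
  "C_vector r = {f. \<forall>j. (\<lambda>x. f x $ j) \<in> C_scalar r}"

definition F_class :: "nat \<Rightarrow> (real^'d::finite) set \<Rightarrow> real \<Rightarrow> (real^'d \<Rightarrow> real^'d) set" where
  "F_class r M D = {f \<in> C_vector r. (\<forall>y. y \<notin> M \<longrightarrow> f y = 0) \<and>
     (\<forall>is j y. length is \<le> r \<longrightarrow> \<bar>iter_partial is (\<lambda>x. f x $ j) y\<bar> \<le> D)}"

definition solves_ivp ::
  "real \<Rightarrow> real \<Rightarrow> real^'d::finite \<Rightarrow> (real^'d \<Rightarrow> real^'d) \<Rightarrow> (real \<Rightarrow> real^'d) \<Rightarrow> bool" where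
  "solves_ivp a b \<eta> f z \<longleftrightarrow> z a = \<eta> \<and>
     (\<forall>t\<in>{a..b}. (z has_vector_derivative f (z t)) (at t within {a..b}))"

text \<open>For \<open>f\<close> in \<^const>\<open>F_class\<close> with \<open>r \<ge> 1\<close> the right-hand side is globally Lipschitz, so a
  solution exists and is unique on \<open>{a..b}\<close>; the choice only affects irrelevant values
  outside \<open>{a..b}\<close>.\<close>

definition ivp_solution ::
  "real \<Rightarrow> real \<Rightarrow> real^'d::finite \<Rightarrow> (real^'d \<Rightarrow> real^'d) \<Rightarrow> real \<Rightarrow> real^'d" where
  "ivp_solution a b \<eta> f = (SOME z. solves_ivp a b \<eta> f z)"

type_synonym 'd functional = "(real^'d \<Rightarrow> real^'d) \<Rightarrow> real"

text \<open>Functionals are total on the function type, but they are constrained only on \<open>C\<^sup>r\<close>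
  functions. No continuity is required.\<close>

definition linear_functional :: "nat \<Rightarrow> 'd::finite functional \<Rightarrow> bool" where
  "linear_functional r L \<longleftrightarrow>
     (\<forall>f\<in>C_vector r. \<forall>g\<in>C_vector r. L (\<lambda>x. f x + g x) = L f + L g) \<and>
     (\<forall>c. \<forall>f\<in>C_vector r. L (\<lambda>x. c *\<^sub>R f x) = c * L f)"

definition standard_functional :: "nat \<Rightarrow> 'd::finite functional \<Rightarrow> bool" where
  "standard_functional r L \<longleftrightarrow>
     (\<exists>is i y. length is \<le> r \<and> (\<forall>f\<in>C_vector r. L f = iter_partial is (\<lambda>x. f x $ i) y))"

text \<open>An information operator \<open>N\<^sub>n\<close> is the list of its \<open>n\<close> functionals; a class of information
  operators assigns to each \<open>n\<close> the set of admissible operators.\<close>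

definition information :: "'d::finite functional list \<Rightarrow> (real^'d \<Rightarrow> real^'d) \<Rightarrow> real list" where
  "information Ls f = map (\<lambda>L. L f) Ls"

definition linear_info :: "nat \<Rightarrow> nat \<Rightarrow> 'd::finite functional list set" where
  "linear_info r n = {Ls. length Ls = n \<and> (\<forall>L\<in>set Ls. linear_functional r L)}"

definition mixed_info :: "nat \<Rightarrow> (nat \<Rightarrow> nat) \<Rightarrow> nat \<Rightarrow> 'd::finite functional list set" where
  "mixed_info r k n = {Lbars @ Ls | Lbars Ls.
     n \<ge> k n + 1 \<and> length Lbars = n - k n \<and> length Ls = k n \<and>
     (\<forall>L\<in>set Lbars. standard_functional r L) \<and> (\<forall>L\<in>set Ls. linear_functional r L)}"

text \<open>\<open>infnorm\<close> is the maximum norm on \<open>real^'d\<close>. An algorithm is an arbitrary map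
  from information vectors to functions; only its values on \<open>{a..b}\<close> matter.\<close>

definition worst_case_error ::
  "real \<Rightarrow> real \<Rightarrow> real^'d::finite \<Rightarrow> (real^'d \<Rightarrow> real^'d) set \<Rightarrow>
   (real list \<Rightarrow> real \<Rightarrow> real^'d) \<Rightarrow> 'd functional list \<Rightarrow> ereal" where
  "worst_case_error a b \<eta> F \<Phi> Ls =
     (SUP f\<in>F. SUP t\<in>{a..b}. ereal (infnorm (ivp_solution a b \<eta> f t - \<Phi> (information Ls f) t)))"

text \<open>The infimum in \<^typ>\<open>enat\<close> is the minimum of a nonempty set, and \<open>\<infinity>\<close> for the empty set.\<close>

definition comp_nonad ::
  "real \<Rightarrow> real \<Rightarrow> real^'d::finite \<Rightarrow> (real^'d \<Rightarrow> real^'d) set \<Rightarrow>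
   (nat \<Rightarrow> 'd functional list set) \<Rightarrow> real \<Rightarrow> enat" where
  "comp_nonad a b \<eta> F \<N> \<epsilon> =
     Inf {enat n | n. n \<ge> 1 \<and> (\<exists>Ls\<in>\<N> n. \<exists>\<Phi>. worst_case_error a b \<eta> F \<Phi> Ls \<le> ereal \<epsilon>)}"

end

theory Submission
  imports Defs
begin

text \<open>The adversary splits a small cube next to \<open>\<eta>\<close> into \<open>m ^ d\<close> cells, each carrying a bump
  field of height of order \<open>m ^ -r\<close> in one fixed direction. Since the information is chosen in
  advance, linear algebra gives a combination \<open>h\<close> of these bumps that it does not see, with a
  coefficient of maximal modulus \<open>1\<close> at some block of cells in a column of the cube. Only then is
  the base field \<open>f\<close> fixed: it steers the solution from \<open>\<eta>\<close> into that column and along it at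
  constant speed. The fields \<open>f\<close> and \<open>f + h\<close> carry the same information, while a block of \<open>q\<close>
  cells with coefficient \<open>1\<close> separates the solutions by order \<open>q * m ^ -(r + 1)\<close>. Blocks that are
  single cells or entire columns give the two rates for linear information. A standard functional
  sees at most one cell; with a number of blocks per column that depends on \<open>\<alpha>\<close> only, enough
  blocks keep half of their cells unseen, and the remaining linear functionals are too few to
  exclude all of these blocks.\<close>

section \<open>One-variable functions of class \<open>C\<^sup>r\<close>\<close>

text \<open>All perturbations point along the axis \<open>i0\<close>, which is also the direction of
  travel. A cell changes how fast the solution moves but not the curve on which it moves, so the
  vector problem becomes one autonomous scalar equation, solved by separation of variables. A cell
  has length of order 1/m and changes the speed by order m^-r, hence the exponent r + 1. The
  obstacle is the sign of the other coefficients. The kernel vector is controlled at one block only,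
  and cells met earlier in the same column may have pushed the solution either way. The deviation is
  therefore compared at the entry to the block and at the exit from it: the two values differ by the
  gain of the block, so one of them is at least half of that gain in modulus. The maximal modulus 1
  keeps the perturbed field in the class: the cells have disjoint interiors, so a derivative of the
  whole sum is bounded like that of a single cell, and base and perturbation each get half of the
  bound \<open>D\<close>.\<close>

definition C_real :: "nat \<Rightarrow> (real \<Rightarrow> real) set" where
  "C_real r = {f. (\<forall>i<r. \<forall>x. (deriv ^^ i) f field_differentiable at x) \<and>
     (\<forall>i\<le>r. continuous_on UNIV ((deriv ^^ i) f))}"

lemma C_real_0: "f \<in> C_real 0 \<longleftrightarrow> continuous_on UNIV f"
  by (simp add: C_real_def)

lemma deriv_pow_Suc: "(deriv ^^ Suc i) f = (deriv ^^ i) (deriv f)"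
  by (simp add: funpow_swap1)

text \<open>Peels off the first derivative rather than the last, so that closure properties follow
  by induction on \<open>r\<close> with the functions generalised.\<close>

lemma C_real_Suc:
  "f \<in> C_real (Suc r) \<longleftrightarrow> (\<forall>x. f field_differentiable at x) \<and> deriv f \<in> C_real r"
proof -
  have 1: "(\<forall>i<Suc r. \<forall>x. (deriv ^^ i) f field_differentiable at x) \<longleftrightarrow>
    (\<forall>x. f field_differentiable at x) \<and> (\<forall>i<r. \<forall>x. (deriv ^^ i) (deriv f) field_differentiable at x)"
    by (simp add: All_less_Suc2 deriv_pow_Suc del: funpow.simps(2))
  have 2: "(\<forall>i\<le>Suc r. continuous_on UNIV ((deriv ^^ i) f)) \<longleftrightarrow>
    continuous_on UNIV f \<and> (\<forall>i\<le>r. continuous_on UNIV ((deriv ^^ i) (deriv f)))"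
    by (simp flip: less_Suc_eq_le add: All_less_Suc2 deriv_pow_Suc del: funpow.simps(2))
  have 3: "continuous_on UNIV f" if "\<forall>x. f field_differentiable at x"
    using that by (simp add: continuous_on_eq_continuous_at field_differentiable_imp_continuous_at)
  show ?thesis using 1 2 3 by (auto simp: C_real_def simp del: funpow.simps(2))
qed

lemma C_real_SucI:
  assumes "\<And>x. (f has_real_derivative f' x) (at x)" "f' \<in> C_real r"
  shows "f \<in> C_real (Suc r)"
proof -
  have "deriv f = f'" using assms(1) DERIV_imp_deriv by blast
  then show ?thesis using assms field_differentiable_def by (auto simp: C_real_Suc)
qed

lemma C_real_has_derivative:
  "f \<in> C_real r \<Longrightarrow> i < r \<Longrightarrow> ((deriv ^^ i) f has_real_derivative (deriv ^^ Suc i) f x) (at x)"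
  by (auto simp: C_real_def DERIV_deriv_iff_field_differentiable)

lemma C_real_continuous: "f \<in> C_real r \<Longrightarrow> i \<le> r \<Longrightarrow> continuous_on A ((deriv ^^ i) f)"
  unfolding C_real_def by (blast intro: continuous_on_subset)

lemma C_real_mono: "f \<in> C_real r \<Longrightarrow> k \<le> r \<Longrightarrow> f \<in> C_real k"
  by (auto simp: C_real_def)

lemma C_real_add: "f \<in> C_real r \<Longrightarrow> g \<in> C_real r \<Longrightarrow> (\<lambda>x. f x + g x) \<in> C_real r"
proof (induction r arbitrary: f g)
  case (Suc r)
  show ?case
    by (rule C_real_SucI[where f' = "\<lambda>x. deriv f x + deriv g x"])
      (use Suc in \<open>auto simp: C_real_Suc DERIV_deriv_iff_field_differentiable intro!: DERIV_add\<close>)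
qed (auto simp: C_real_0 intro: continuous_intros)

lemma C_real_const: "(\<lambda>x. c) \<in> C_real r"
proof (induction r arbitrary: c)
  case (Suc r)
  show ?case by (rule C_real_SucI[where f' = "\<lambda>x. 0"]) (use Suc in auto)
qed (auto simp: C_real_0)

text \<open>The product rule leads back to sums of products one class lower; induction over all
  pairs of functions replaces the Leibniz formula.\<close>

lemma C_real_mult: "f \<in> C_real r \<Longrightarrow> g \<in> C_real r \<Longrightarrow> (\<lambda>x. f x * g x) \<in> C_real r"
proof (induction r arbitrary: f g)
  case (Suc r)
  have "f \<in> C_real r" "g \<in> C_real r" using Suc.prems C_real_mono le_SucI by blast+
  then show ?case
    by (intro C_real_SucI[where f' = "\<lambda>x. deriv f x * g x + deriv g x * f x"] C_real_add Suc.IH DERIV_mult)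
      (use Suc.prems in \<open>auto simp: C_real_Suc DERIV_deriv_iff_field_differentiable\<close>)
qed (auto simp: C_real_0 intro: continuous_intros)

lemma deriv_pow_affine:
  assumes "f \<in> C_real r" "i \<le> r"
  shows "(deriv ^^ i) (\<lambda>x. f (c * x + e)) = (\<lambda>x. c ^ i * (deriv ^^ i) f (c * x + e))"
  using assms(2)
proof (induction i)
  case (Suc i)
  have "((\<lambda>x. c ^ i * (deriv ^^ i) f (c * x + e)) has_real_derivative
      c ^ Suc i * (deriv ^^ Suc i) f (c * x + e)) (at x)" for x
  proof -
    have "((\<lambda>x. (deriv ^^ i) f (c * x + e)) has_real_derivative (deriv ^^ Suc i) f (c * x + e) * c) (at x)"
      by (rule DERIV_chain2[of "(deriv ^^ i) f"])
        (use Suc.prems assms(1) C_real_has_derivative in \<open>auto intro!: derivative_eq_intros simp del: funpow.simps(2)\<close>)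
    from DERIV_cmult[OF this, of "c ^ i"] show ?thesis by (simp add: mult_ac)
  qed
  then have "deriv (\<lambda>x. c ^ i * (deriv ^^ i) f (c * x + e)) = (\<lambda>x. c ^ Suc i * (deriv ^^ Suc i) f (c * x + e))"
    by (intro ext DERIV_imp_deriv)
  then show ?case using Suc by simp
qed auto

lemma C_real_affine:
  assumes "f \<in> C_real r" shows "(\<lambda>x. f (c * x + e)) \<in> C_real r"
  using assms
proof (induction r arbitrary: f)
  case 0
  then show ?case by (auto simp: C_real_0 intro!: continuous_intros continuous_on_compose2[of UNIV f])
next
  case (Suc r)
  have "((\<lambda>x. f (c * x + e)) has_real_derivative deriv f (c * x + e) * c) (at x)" for x
    by (rule DERIV_chain2[of f])
       (use Suc.prems in \<open>auto simp: C_real_Suc DERIV_deriv_iff_field_differentiable intro!: derivative_eq_intros\<close>)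
  then show ?case
    by (rule C_real_SucI) (use Suc in \<open>auto simp: C_real_Suc intro!: C_real_mult C_real_const\<close>)
qed

text \<open>Only the point 0 needs an argument: the difference quotient there is at most
  \<open>max 0 h ^ Suc n\<close>, which tends to 0 because the exponent is positive. Elsewhere the
  function agrees locally with 0 or with a power.\<close>

lemma has_derivative_pos_part_power:
  "((\<lambda>x::real. (max 0 x) ^ Suc (Suc n)) has_real_derivative (real n + 2) * (max 0 x) ^ Suc n) (at x)"
proof (cases x "0::real" rule: linorder_cases)
  case less
  have "((\<lambda>x::real. 0) has_real_derivative 0) (at x)" by simp
  then have "((\<lambda>x::real. (max 0 x) ^ Suc (Suc n)) has_real_derivative 0) (at x)"
    by (rule has_field_derivative_transform_within_open[of _ _ _ "{..<0}"]) (use less in auto)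
  then show ?thesis using less by simp
next
  case equal
  have "((\<lambda>h::real. max 0 h ^ Suc (Suc n) / h) \<longlongrightarrow> 0) (at 0)"
  proof (rule Lim_null_comparison)
    show "\<forall>\<^sub>F h in at 0. norm (max 0 h ^ Suc (Suc n) / h) \<le> max 0 h ^ Suc n"
      by (rule always_eventually) (auto simp: max_def)
    have "((\<lambda>h::real. max 0 h ^ Suc n) \<longlongrightarrow> max 0 0 ^ Suc n) (at 0)"
      by (intro tendsto_intros)
    then show "((\<lambda>h::real. max 0 h ^ Suc n) \<longlongrightarrow> 0) (at 0)" by simp
  qed
  then show ?thesis using equal by (simp add: DERIV_def)
next
  case greater
  have "((\<lambda>x::real. x ^ Suc (Suc n)) has_real_derivative (real n + 2) * x ^ Suc n) (at x)"
    by (rule derivative_eq_intros refl | simp)+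
  then have "((\<lambda>x::real. (max 0 x) ^ Suc (Suc n)) has_real_derivative (real n + 2) * x ^ Suc n) (at x)"
    by (rule has_field_derivative_transform_within_open[of _ _ _ "{0<..}"]) (use greater in auto)
  then show ?thesis using greater by simp
qed

lemma C_real_pos_part_power: "(\<lambda>x. (max 0 x) ^ Suc r) \<in> C_real r"
proof (induction r)
  case 0
  then show ?case by (auto simp: C_real_0 intro!: continuous_intros)
next
  case (Suc r)
  show ?case
    by (rule C_real_SucI[OF has_derivative_pos_part_power]) (intro C_real_mult C_real_const Suc)
qed

text \<open>At an endpoint the two-sided derivative exists, so it can be computed from the side on
  which the function vanishes identically; \<open>?S\<close> is that half-line.\<close>

lemma deriv_pow_eq_0_outside:
  assumes "f \<in> C_real r" "i \<le> r" and 0: "\<And>x. x \<le> l \<or> u \<le> x \<Longrightarrow> f x = 0" and x: "x \<le> l \<or> u \<le> x"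
  shows "(deriv ^^ i) f x = 0"
  using \<open>i \<le> r\<close> x
proof (induction i arbitrary: x)
  case (Suc i)
  let ?S = "if x \<le> l then {..x} else {x..}"
  let ?d = "(deriv ^^ Suc i) f x"
  have z: "(deriv ^^ i) f y = 0" if "y \<in> ?S" for y
    using that Suc by (auto split: if_splits)
  have "((deriv ^^ i) f has_real_derivative ?d) (at x within ?S)"
    using C_real_has_derivative[OF assms(1), of i x] Suc.prems has_field_derivative_at_within by auto
  then have 1: "((\<lambda>_. 0) has_real_derivative ?d) (at x within ?S)"
    by (rule has_field_derivative_transform_within[of _ _ _ _ 1]) (use z in auto)
  have 2: "((\<lambda>_. 0) has_real_derivative 0) (at x within ?S)" by simp
  have "at x within ?S \<noteq> bot"
    using trivial_limit_at_left_real[of x] trivial_limit_at_right_real[of x]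
    by (auto simp: at_within_Iic_at_left at_within_Ici_at_right)
  with 1 2 show ?case by (metis has_field_derivative_unique)
qed (use 0 in auto)

lemma compact_support_bounded:
  fixes f :: "real \<Rightarrow> real"
  assumes "continuous_on UNIV f" and 0: "\<And>x. x \<le> l \<or> u \<le> x \<Longrightarrow> f x = 0"
  obtains K where "K \<ge> 0" "\<And>x. \<bar>f x\<bar> \<le> K"
proof -
  have "bounded (f ` {l..u})"
    by (intro compact_imp_bounded compact_continuous_image continuous_on_subset[OF assms(1)]) auto
  then obtain K where K: "\<And>x. x \<in> {l..u} \<Longrightarrow> \<bar>f x\<bar> \<le> K"
    unfolding bounded_iff by (metis imageI real_norm_def)
  have "\<bar>f x\<bar> \<le> max K 0" for x
    using K[of x] 0[of x] by (cases "x \<in> {l..u}") auto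
  then show ?thesis using that[of "max K 0"] by auto
qed

lemma C_real_derivs_bounded:
  assumes "f \<in> C_real r" and 0: "\<And>x. x \<le> l \<or> u \<le> x \<Longrightarrow> f x = 0"
  obtains K where "K \<ge> 1" "\<And>i x. i \<le> r \<Longrightarrow> \<bar>(deriv ^^ i) f x\<bar> \<le> K"
proof -
  have "\<exists>K. i \<le> r \<longrightarrow> (\<forall>x. \<bar>(deriv ^^ i) f x\<bar> \<le> K)" for i
    by (metis C_real_continuous[OF assms(1)] compact_support_bounded deriv_pow_eq_0_outside[OF assms(1) _ 0])
  then obtain K where K: "\<And>i x. i \<le> r \<Longrightarrow> \<bar>(deriv ^^ i) f x\<bar> \<le> K i" by metis
  show ?thesis
  proof (rule that[of "1 + (\<Sum>i\<le>r. \<bar>K i\<bar>)"])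
    fix i x assume "i \<le> r"
    have "\<bar>K i\<bar> \<le> (\<Sum>i\<le>r. \<bar>K i\<bar>)" by (rule member_le_sum) (use \<open>i \<le> r\<close> in auto)
    then show "\<bar>(deriv ^^ i) f x\<bar> \<le> 1 + (\<Sum>i\<le>r. \<bar>K i\<bar>)" using K[OF \<open>i \<le> r\<close>, of x] by linarith
  qed (simp add: sum_nonneg)
qed

lemma continuous_antiderivative:
  fixes f :: "real \<Rightarrow> real"
  assumes "continuous_on UNIV f"
  obtains F where "F 0 = 0" "\<And>x. (F has_real_derivative f x) (at x)"
proof -
  have "\<exists>F. \<forall>x. - \<infinity> < ereal x \<longrightarrow> ereal x < \<infinity> \<longrightarrow> (F has_vector_derivative f x) (at x)"
    by (rule einterval_antiderivative)
       (use assms in \<open>auto simp: continuous_on_eq_continuous_at\<close>)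
  then obtain F where F: "\<And>x. (F has_real_derivative f x) (at x)"
    by (auto simp: has_real_derivative_iff_has_vector_derivative)
  show ?thesis
    by (rule that[of "\<lambda>x. F x - F 0"]) (use F in \<open>auto intro!: derivative_eq_intros\<close>)
qed

section \<open>The bump profile, its antiderivative and a plateau function\<close>

definition bump :: "nat \<Rightarrow> real \<Rightarrow> real" where
  "bump r x = (max 0 x) ^ Suc r * (max 0 (1 - x)) ^ Suc r"

text \<open>The exponent \<open>Suc r\<close> makes a truncated power \<open>r\<close> times
  continuously differentiable; the second factor of \<open>bump\<close> is the first one reflected
  about 1/2.\<close>

lemma bump_C_real: "bump r \<in> C_real r"
proof -
  have "(\<lambda>x. (max 0 ((-1) * x + 1)) ^ Suc r) \<in> C_real r"
    by (rule C_real_affine[OF C_real_pos_part_power])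
  from C_real_mult[OF C_real_pos_part_power this] show ?thesis
    by (simp add: bump_def[abs_def] algebra_simps)
qed

lemma bump_eq_0: "x \<le> 0 \<or> 1 \<le> x \<Longrightarrow> bump r x = 0"
  by (auto simp: bump_def max_def)

lemma bump_nonneg: "0 \<le> bump r x" by (simp add: bump_def)

lemma bump_pos: "0 < x \<Longrightarrow> x < 1 \<Longrightarrow> 0 < bump r x" by (simp add: bump_def max_def)

lemma bump_le_1: "bump r x \<le> 1"
proof -
  have "bump r x \<le> 1 * 1" if "0 < x" "x < 1"
    unfolding bump_def by (rule mult_mono) (use that in \<open>auto intro!: power_le_one simp del: power_Suc\<close>)
  then show ?thesis using bump_eq_0[of x r] by (cases "0 < x \<and> x < 1") auto
qed

text \<open>\<open>P\<close> is a step of class \<open>r\<close> from 0 to the mass \<open>I\<close>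
  of the bump. It serves three times: as the edge of the plateau, as the profile of the steering,
  and as the antiderivative of the perturbation along a ray.\<close>

lemma bump_antiderivative:
  obtains P I where "I > 0" "\<And>x. (P has_real_derivative bump r x) (at x)"
    "\<And>x. x \<le> 0 \<Longrightarrow> P x = 0" "\<And>x. 1 \<le> x \<Longrightarrow> P x = I" "\<And>x. 0 \<le> P x \<and> P x \<le> I"
    "P \<in> C_real r"
proof -
  obtain P where P: "P 0 = 0" "\<And>x. (P has_real_derivative bump r x) (at x)"
    by (rule continuous_antiderivative[of "bump r"]) (use bump_C_real[of r] in \<open>auto simp: C_real_def\<close>)
  have d0: "(P has_real_derivative 0) (at x)" if "x \<le> 0 \<or> 1 \<le> x" for x
    using P(2)[of x] bump_eq_0[OF that, of r] by simp
  have cont: "continuous_on A P" for A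
    using P(2) by (blast intro: continuous_at_imp_continuous_on DERIV_isCont)
  have mono: "P x \<le> P y" if "x \<le> y" for x y
    by (rule DERIV_nonneg_imp_nondecreasing[OF that]) (use P(2) bump_nonneg in blast)
  have low: "P x = 0" if "x \<le> 0" for x
  proof -
    have "P x = P 0" if "x < 0"
      by (rule DERIV_isconst_end[of x 0 P, symmetric])
        (use that cont d0 in auto)
    then show ?thesis using P(1) that by (cases "x = 0") auto
  qed
  have high: "P x = P 1" if "1 \<le> x" for x
  proof -
    have "P x = P 1" if "1 < x"
      by (rule DERIV_isconst_end[of 1 x P])
        (use that cont d0 in auto)
    then show ?thesis using that by (cases "x = 1") auto
  qed
  have ex: "\<exists>y. (P has_real_derivative y) (at x) \<and> 0 < y" if "0 < x" "x < 1" for x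
    using P(2)[of x] bump_pos[OF that, of r] by blast
  have "P 0 < P 1"
    by (rule DERIV_pos_imp_increasing_open[of 0 1 P])
      (use ex cont in auto)
  moreover have "0 \<le> P x \<and> P x \<le> P 1" for x
    using low[of x] high[of x] mono[of x 1] mono[of 0 x] \<open>P 0 < P 1\<close> P(1)
    by (cases "x \<le> 0"; cases "1 \<le> x") auto
  moreover have "P \<in> C_real r"
    by (rule C_real_mono[OF C_real_SucI[OF P(2) bump_C_real]]) simp
  ultimately show ?thesis using that[of "P 1" P] P low high by metis
qed

lemma plateau:
  assumes "\<rho> > 0"
  obtains c where "c \<in> C_real r" "\<And>x. \<bar>x\<bar> \<le> \<rho> \<Longrightarrow> c x = 1" "\<And>x. 2 * \<rho> \<le> \<bar>x\<bar> \<Longrightarrow> c x = 0"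
proof -
  obtain P I where P: "I > 0" "\<And>x. x \<le> 0 \<Longrightarrow> P x = 0" "\<And>x. 1 \<le> x \<Longrightarrow> P x = I" "P \<in> C_real r"
    by (rule bump_antiderivative[of r]) blast
  \<comment> \<open>The first step rises between \<open>- 2 * \<rho>\<close> and
    \<open>- \<rho>\<close>, the second between \<open>\<rho>\<close> and \<open>2 * \<rho>\<close>;
    the plateau is their normalised difference.\<close>
  define c where "c x = (1 / I) * P ((1/\<rho>) * x + 2) + (- 1 / I) * P ((1/\<rho>) * x + (- 1))" for x
  have "c \<in> C_real r" unfolding c_def
    by (intro C_real_add C_real_mult C_real_const C_real_affine P)
  moreover have "c x = 1" if "\<bar>x\<bar> \<le> \<rho>" for x
    using that \<open>\<rho> > 0\<close> P(1)
    by (simp add: c_def P(2,3) divide_simps)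
  moreover have "c x = 0" if "2 * \<rho> \<le> \<bar>x\<bar>" for x
  proof (cases "x \<ge> 0")
    case True
    then have "(1/\<rho>) * x + 2 \<ge> 1" "(1/\<rho>) * x + (-1) \<ge> 1"
      using that \<open>\<rho> > 0\<close> by (auto simp: field_simps)
    then show ?thesis by (simp add: c_def P(3))
  next
    case False
    then have "(1/\<rho>) * x + 2 \<le> 0" "(1/\<rho>) * x + (-1) \<le> 0"
      using that \<open>\<rho> > 0\<close> by (auto simp: field_simps)
    then show ?thesis by (simp add: c_def P(2))
  qed
  ultimately show ?thesis using that by blast
qed

section \<open>Tensor products and partial derivatives\<close>

abbreviation tensor :: "('d::finite \<Rightarrow> real \<Rightarrow> real) \<Rightarrow> real^'d \<Rightarrow> real" where
  "tensor \<phi> \<equiv> (\<lambda>x. \<Prod>l\<in>UNIV. \<phi> l (x $ l))"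

lemma tensor_has_partial:
  fixes y :: "real^'d::finite"
  assumes "(\<psi> i has_real_derivative D) (at (y $ i))"
  shows "((\<lambda>s. tensor \<psi> (y + s *\<^sub>R axis i 1)) has_real_derivative
           D * (\<Prod>l\<in>UNIV - {i}. \<psi> l (y $ l))) (at 0)"
proof -
  have "((\<lambda>s. \<psi> i (y $ i + s)) has_real_derivative D * 1) (at 0)"
    by (rule DERIV_chain2[of "\<psi> i"]) (use assms in \<open>auto intro!: derivative_eq_intros\<close>)
  then have 1: "((\<lambda>s. \<psi> i (y $ i + s) * (\<Prod>l\<in>UNIV - {i}. \<psi> l (y $ l))) has_real_derivative
      D * (\<Prod>l\<in>UNIV - {i}. \<psi> l (y $ l))) (at 0)"
    by (auto intro!: DERIV_cmult_right)
  have "tensor \<psi> (y + s *\<^sub>R axis i 1) = \<psi> i (y $ i + s) * (\<Prod>l\<in>UNIV - {i}. \<psi> l (y $ l))" for s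
    by (subst prod.remove[of _ i]) (auto simp: axis_def intro!: prod.cong arg_cong2[of _ _ _ _ "(*)"])
  with 1 show ?thesis by simp
qed

text \<open>The variables separate, so only the number of occurrences of each direction in
  \<open>is\<close> matters. This number is at most the length, hence at most
  \<open>r\<close>.\<close>

lemma iter_partial_tensor:
  fixes \<phi> :: "'d::finite \<Rightarrow> real \<Rightarrow> real"
  assumes "\<And>l. \<phi> l \<in> C_real r" "length is \<le> r"
  shows "iter_partial is (tensor \<phi>) = tensor (\<lambda>l. (deriv ^^ count_list is l) (\<phi> l))"
  using assms(2)
proof (induction "is")
  case (Cons i "is")
  have c: "count_list is i < r" using Cons.prems count_le_length[of "is" i] by simp
  have IH: "iter_partial is (tensor \<phi>) = tensor (\<lambda>l. (deriv ^^ count_list is l) (\<phi> l))"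
    using Cons by simp
  show ?case
  proof
    fix y
    have "iter_partial (i # is) (tensor \<phi>) y
        = (deriv ^^ Suc (count_list is i)) (\<phi> i) (y $ i) *
          (\<Prod>l\<in>UNIV - {i}. (deriv ^^ count_list is l) (\<phi> l) (y $ l))"
      unfolding iter_partial.simps IH partial_deriv_def
      by (rule DERIV_imp_deriv, rule tensor_has_partial[of "\<lambda>l. (deriv ^^ count_list is l) (\<phi> l)"],
          rule C_real_has_derivative[OF assms(1) c])
    also have "\<dots> = tensor (\<lambda>l. (deriv ^^ count_list (i # is) l) (\<phi> l)) y"
      by (subst prod.remove[of UNIV i]) (auto intro!: prod.cong)
    finally show "iter_partial (i # is) (tensor \<phi>) y = tensor (\<lambda>l. (deriv ^^ count_list (i # is) l) (\<phi> l)) y" .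
  qed
qed auto

lemma tensor_C_scalar:
  fixes \<phi> :: "'d::finite \<Rightarrow> real \<Rightarrow> real"
  assumes "\<And>l. \<phi> l \<in> C_real r"
  shows "tensor \<phi> \<in> C_scalar r"
  unfolding C_scalar_def
proof (intro CollectI conjI allI impI)
  fix "is" :: "'d list" and i y assume l: "length is < r"
  then have "count_list is i < r" using count_le_length[of "is" i] by simp
  from tensor_has_partial[of "\<lambda>l. (deriv ^^ count_list is l) (\<phi> l)", OF C_real_has_derivative[OF assms this]]
  show "has_partial i (iter_partial is (tensor \<phi>)) y"
    using l unfolding has_partial_def field_differentiable_def
    by (subst iter_partial_tensor[OF assms]) auto
next
  fix "is" :: "'d list" assume l: "length is \<le> r"
  have "count_list is i \<le> r" for i using l count_le_length[of "is" i] by simp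
  then show "continuous_on UNIV (iter_partial is (tensor \<phi>))"
    by (subst iter_partial_tensor[OF assms l])
      (auto intro!: continuous_intros continuous_on_compose2[OF C_real_continuous[OF assms]])
qed

lemma iter_partial_add:
  assumes "g \<in> C_scalar r" "h \<in> C_scalar r" "length is \<le> r"
  shows "iter_partial is (\<lambda>x. g x + h x) = (\<lambda>x. iter_partial is g x + iter_partial is h x)"
  using assms(3)
proof (induction "is")
  case (Cons i "is")
  then have "has_partial i (iter_partial is g) y" "has_partial i (iter_partial is h) y" for y
    using assms(1,2) by (auto simp: C_scalar_def)
  then show ?case using Cons by (auto simp: partial_deriv_def has_partial_def)
qed auto

lemma iter_partial_cmult:
  assumes "g \<in> C_scalar r" "length is \<le> r"
  shows "iter_partial is (\<lambda>x. c * g x) = (\<lambda>x. c * iter_partial is g x)"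
  using assms(2)
proof (induction "is")
  case (Cons i "is")
  then have "has_partial i (iter_partial is g) y" for y
    using assms(1) by (auto simp: C_scalar_def)
  then show ?case using Cons by (auto simp: partial_deriv_def has_partial_def)
qed auto

lemma C_scalar_add:
  assumes "g \<in> C_scalar r" "h \<in> C_scalar r"
  shows "(\<lambda>x. g x + h x) \<in> C_scalar r"
  using assms iter_partial_add[OF assms]
  by (auto simp: C_scalar_def has_partial_def intro!: continuous_intros field_differentiable_add)

lemma C_scalar_cmult:
  assumes "g \<in> C_scalar r"
  shows "(\<lambda>x. c * g x) \<in> C_scalar r"
  using assms iter_partial_cmult[OF assms]
  by (auto simp: C_scalar_def has_partial_def intro!: continuous_intros field_differentiable_mult)

lemma C_scalar_0: "(\<lambda>x. 0) \<in> C_scalar r"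
  using C_scalar_cmult[OF tensor_C_scalar[OF C_real_const[of 0 r]], of 0] by simp

lemma iter_partial_0: "length is \<le> r \<Longrightarrow> iter_partial is (\<lambda>x. 0) = (\<lambda>x. 0)"
  using iter_partial_cmult[OF C_scalar_0[of r], of "is" 0] by simp

lemma
  assumes "\<And>i. i \<in> I \<Longrightarrow> g i \<in> C_scalar r"
  shows C_scalar_sum: "(\<lambda>x. \<Sum>i\<in>I. g i x) \<in> C_scalar r"
    and iter_partial_sum: "length is \<le> r \<Longrightarrow>
      iter_partial is (\<lambda>x. \<Sum>i\<in>I. g i x) = (\<lambda>x. \<Sum>i\<in>I. iter_partial is (g i) x)"
proof -
  \<comment> \<open>Both claims go through one induction: differentiating the sum over
    \<open>insert j I\<close> needs that the sum over \<open>I\<close> is of class \<open>r\<close>.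
    An infinite \<open>I\<close> gives the zero function.\<close>
  have "(\<lambda>x. \<Sum>i\<in>I. g i x) \<in> C_scalar r \<and> (length is \<le> r \<longrightarrow>
      iter_partial is (\<lambda>x. \<Sum>i\<in>I. g i x) = (\<lambda>x. \<Sum>i\<in>I. iter_partial is (g i) x))"
    using assms
  proof (induction I rule: infinite_finite_induct)
    case (insert j I)
    then show ?case using C_scalar_add[of "g j" r] iter_partial_add[of "g j" r] by simp
  qed (auto simp: C_scalar_0 iter_partial_0)
  then show "(\<lambda>x. \<Sum>i\<in>I. g i x) \<in> C_scalar r" and "length is \<le> r \<Longrightarrow>
      iter_partial is (\<lambda>x. \<Sum>i\<in>I. g i x) = (\<lambda>x. \<Sum>i\<in>I. iter_partial is (g i) x)" by auto
qed

lemma C_vector_add: "f \<in> C_vector r \<Longrightarrow> g \<in> C_vector r \<Longrightarrow> (\<lambda>x. f x + g x) \<in> C_vector r"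
  by (simp add: C_vector_def C_scalar_add)

lemma C_vector_scaleR: "f \<in> C_vector r \<Longrightarrow> (\<lambda>x. c *\<^sub>R f x) \<in> C_vector r"
  by (simp add: C_vector_def C_scalar_cmult)

lemma C_vector_sum: "(\<And>i. i \<in> I \<Longrightarrow> f i \<in> C_vector r) \<Longrightarrow> (\<lambda>x. \<Sum>i\<in>I. f i x) \<in> C_vector r"
  by (simp add: C_vector_def C_scalar_sum)

lemma standard_imp_linear_functional:
  assumes "standard_functional r L" shows "linear_functional r L"
proof -
  obtain "is" i y where l: "length is \<le> r" and
    L: "\<And>f. f \<in> C_vector r \<Longrightarrow> L f = iter_partial is (\<lambda>x. f x $ i) y"
    using assms by (auto simp: standard_functional_def)
  have "(\<lambda>x. f x $ i) \<in> C_scalar r" if "f \<in> C_vector r" for f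
    using that by (simp add: C_vector_def)
  then show ?thesis
    by (simp add: linear_functional_def L C_vector_add C_vector_scaleR
        iter_partial_add[OF _ _ l] iter_partial_cmult[OF _ l])
qed

lemma linear_functional_sum:
  assumes L: "linear_functional r L" and f: "\<And>i. i \<in> I \<Longrightarrow> f i \<in> C_vector r"
  shows "L (\<lambda>x. \<Sum>i\<in>I. c i *\<^sub>R f i x) = (\<Sum>i\<in>I. c i * L (f i))"
proof -
  have sc: "L (\<lambda>x. c *\<^sub>R g x) = c * L g" if "g \<in> C_vector r" for c g
    using L that by (simp add: linear_functional_def)
  have "(\<lambda>x. 0) \<in> (C_vector r :: (real^'a \<Rightarrow> real^'a) set)" by (simp add: C_vector_def C_scalar_0)
  from sc[OF this, of 0] have z: "L (\<lambda>x. 0) = 0" by simp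
  have add: "L (\<lambda>x. g x + h x) = L g + L h" if "g \<in> C_vector r" "h \<in> C_vector r" for g h
    using L that by (simp add: linear_functional_def)
  show ?thesis using f
    by (induction I rule: infinite_finite_induct)
       (auto simp: z sc add C_vector_sum C_vector_scaleR)
qed

section \<open>Lipschitz bound and uniqueness for the initial-value problem\<close>

lemma has_partial_along_axis:
  assumes "\<And>y. has_partial i g y"
  shows "((\<lambda>s. g (p + s *\<^sub>R axis i 1)) has_real_derivative partial_deriv i g (p + s *\<^sub>R axis i 1)) (at s)"
proof -
  have "((\<lambda>h. g (p + s *\<^sub>R axis i 1 + h *\<^sub>R axis i 1)) has_real_derivative partial_deriv i g (p + s *\<^sub>R axis i 1)) (at 0)"
    using assms by (simp add: has_partial_def partial_deriv_def DERIV_deriv_iff_field_differentiable)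
  moreover have "g (p + s *\<^sub>R axis i 1 + h *\<^sub>R axis i 1) = g (p + (h + s) *\<^sub>R axis i 1)" for h
    by (simp add: algebra_simps)
  ultimately show ?thesis
    using DERIV_shift[of "\<lambda>s. g (p + s *\<^sub>R axis i 1)" _ 0 s] by simp
qed

text \<open>The coordinates of \<open>x\<close> are replaced by those of \<open>y\<close> one at a
  time, and each replacement is a one-dimensional mean value estimate. Total differentiability never
  enters.\<close>

lemma lipschitz_partial_derivs:
  fixes g :: "real^'d::finite \<Rightarrow> real"
  assumes p: "\<And>i y. has_partial i g y" and D: "\<And>i y. \<bar>partial_deriv i g y\<bar> \<le> D"
  shows "\<bar>g y - g x\<bar> \<le> D * (\<Sum>i\<in>UNIV. \<bar>y $ i - x $ i\<bar>)"
proof -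
  have "\<bar>g (\<chi> l. if l \<in> S then y $ l else x $ l) - g x\<bar> \<le> D * (\<Sum>i\<in>S. \<bar>y $ i - x $ i\<bar>)"
    if "finite S" for S :: "'d set"
    using that
  proof (induction S)
    case empty
    have "(\<chi> l. if l \<in> {} then y $ l else x $ l) = x" by (simp add: vec_eq_iff)
    then show ?case by simp
  next
    case (insert i S)
    let ?p = "\<chi> l. if l \<in> S then y $ l else x $ l"
    have q: "(\<chi> l. if l \<in> insert i S then y $ l else x $ l) = ?p + (y $ i - x $ i) *\<^sub>R axis i 1"
      using insert.hyps by (auto simp: vec_eq_iff axis_def)
    have "norm (g (?p + (y $ i - x $ i) *\<^sub>R axis i 1) - g (?p + 0 *\<^sub>R axis i 1)) \<le> D * norm (y $ i - x $ i - 0)"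
      by (rule field_differentiable_bound[OF convex_UNIV has_partial_along_axis[OF p]]) (use D in auto)
    then show ?case unfolding q using insert by (simp add: algebra_simps)
  qed
  from this[of UNIV] show ?thesis by simp
qed

lemma F_class_lipschitz:
  fixes f :: "real^'d::finite \<Rightarrow> real^'d"
  assumes "f \<in> F_class r M D" "r \<ge> 1"
  obtains L where "L \<ge> 0" "\<And>x y. norm (f x - f y) \<le> L * norm (x - y)"
proof -
  have C: "(\<lambda>x. f x $ j) \<in> C_scalar r" for j
    using assms by (auto simp: F_class_def C_vector_def)
  \<comment> \<open>The bound of order 0, at an arbitrary component and point, forces
    \<open>D\<close> to be nonnegative.\<close>
  have "\<bar>iter_partial [] (\<lambda>x. f x $ undefined) undefined\<bar> \<le> D"
    using assms by (auto simp: F_class_def simp del: iter_partial.simps)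
  then have D0: "D \<ge> 0" by linarith
  have 1: "\<bar>f x $ j - f y $ j\<bar> \<le> D * (\<Sum>i\<in>UNIV. \<bar>x $ i - y $ i\<bar>)" for j x y
  proof (rule lipschitz_partial_derivs)
    show "has_partial i (\<lambda>x. f x $ j) y" for i y
      using C[of j] assms(2) unfolding C_scalar_def by (auto dest!: spec[of _ "[]"])
    have "length [i] \<le> r" for i :: 'd using assms(2) by simp
    then have "\<bar>iter_partial [i] (\<lambda>x. f x $ j) y\<bar> \<le> D" for i y
      using assms(1) unfolding F_class_def by blast
    then show "\<bar>partial_deriv i (\<lambda>x. f x $ j) y\<bar> \<le> D" for i y by simp
  qed
  have 2: "(\<Sum>i\<in>UNIV. \<bar>x $ i - y $ i\<bar>) \<le> CARD('d) * norm (x - y)" for x y :: "real^'d"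
    using sum_bounded_above[of UNIV "\<lambda>i. \<bar>x $ i - y $ i\<bar>" "norm (x - y)"] component_le_norm_cart[of "x - y"]
    by auto
  have "norm (f x - f y) \<le> (CARD('d) * (D * CARD('d))) * norm (x - y)" for x y
  proof -
    have "norm (f x - f y) \<le> (\<Sum>j\<in>UNIV. \<bar>(f x - f y) $ j\<bar>)" by (rule norm_le_l1_cart)
    also have "\<dots> \<le> (\<Sum>j\<in>(UNIV::'d set). D * (CARD('d) * norm (x - y)))"
    proof (rule sum_mono)
      fix j
      show "\<bar>(f x - f y) $ j\<bar> \<le> D * (CARD('d) * norm (x - y))"
        using 1[of x j y] mult_left_mono[OF 2[of x y] D0] by simp
    qed
    finally show ?thesis by (simp add: mult_ac)
  qed
  then show ?thesis using that[of "CARD('d) * (D * CARD('d))"] D0 by auto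
qed

text \<open>Gronwall's argument: by the Lipschitz bound the squared distance times
  \<open>exp (- 2 * L * t)\<close> is nonincreasing, and it starts at 0. The square stays
  differentiable where the solutions meet.\<close>

lemma solves_ivp_unique:
  assumes L: "L \<ge> 0" "\<And>x y. norm (f x - f y) \<le> L * norm (x - y)"
    and z: "solves_ivp a b \<eta> f z" and w: "solves_ivp a b \<eta> f w" and t: "t \<in> {a..b}"
  shows "z t = w t"
proof -
  define u where "u t = (z t - w t) \<bullet> (z t - w t)" for t
  define E where "E t = exp (- 2 * L * t) * u t" for t
  have E': "(E has_real_derivative exp (- 2 * L * t) * (2 * ((z t - w t) \<bullet> (f (z t) - f (w t))) - 2 * L * u t))
      (at t within {a..b})" if "t \<in> {a..b}" for t
  proof -
    have "(z has_vector_derivative f (z t)) (at t within {a..b})" "(w has_vector_derivative f (w t)) (at t within {a..b})"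
      using z w that by (auto simp: solves_ivp_def)
    from has_vector_derivative_diff[OF this]
    have d: "((\<lambda>t. z t - w t) has_vector_derivative (f (z t) - f (w t))) (at t within {a..b})" .
    have "(u has_real_derivative 2 * ((z t - w t) \<bullet> (f (z t) - f (w t)))) (at t within {a..b})"
      using has_derivative_inner[OF d[unfolded has_vector_derivative_def] d[unfolded has_vector_derivative_def]]
      unfolding u_def[abs_def] has_field_derivative_def
      by (rule has_derivative_eq_rhs) (auto simp: inner_commute fun_eq_iff algebra_simps)
    then show ?thesis unfolding E_def[abs_def]
      by (auto intro!: derivative_eq_intros simp: algebra_simps)
  qed
  have neg: "exp (- 2 * L * t) * (2 * ((z t - w t) \<bullet> (f (z t) - f (w t))) - 2 * L * u t) \<le> 0" for t
  proof -
    have "(z t - w t) \<bullet> (f (z t) - f (w t)) \<le> norm (z t - w t) * norm (f (z t) - f (w t))"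
      by (rule norm_cauchy_schwarz)
    also have "\<dots> \<le> norm (z t - w t) * (L * norm (z t - w t))"
      using L(2) by (intro mult_left_mono) auto
    also have "\<dots> = L * u t" by (simp add: u_def power2_norm_eq_inner[symmetric] power2_eq_square)
    finally show ?thesis by (auto intro: mult_nonneg_nonpos)
  qed
  have "E t \<le> E a"
  proof (cases "a = t")
    case False
    then have at: "a \<le> t" "a < t" "t \<le> b" using t by auto
    show ?thesis
    proof (rule DERIV_nonpos_imp_decreasing_open[OF at(1)])
      fix x assume x: "a < x" "x < t"
      then have "x \<in> {a..b}" "at x within {a..b} = at x" using at by (auto simp: at_within_Icc_at)
      with E'[of x] neg[of x] show "\<exists>y. (E has_real_derivative y) (at x) \<and> y \<le> 0" by auto
    next
      have "continuous_on {a..b} E"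
        unfolding continuous_on_eq_continuous_within using E' DERIV_continuous by blast
      then show "continuous_on {a..t} E" by (rule continuous_on_subset) (use at in auto)
    qed
  qed simp
  moreover have "E a = 0" using z w by (simp add: E_def u_def solves_ivp_def)
  ultimately have "u t \<le> 0" by (simp add: E_def mult_le_0_iff)
  then show ?thesis using inner_ge_zero[of "z t - w t"] by (simp add: u_def)
qed

text \<open>One explicit solution shows that the chosen \<open>ivp_solution\<close> is a solution at
  all; uniqueness then identifies the two.\<close>

lemma ivp_solution_eq:
  assumes "f \<in> F_class r M D" "r \<ge> 1" "solves_ivp a b \<eta> f z" "t \<in> {a..b}"
  shows "ivp_solution a b \<eta> f t = z t"
proof -
  obtain L where "L \<ge> 0" "\<And>x y. norm (f x - f y) \<le> L * norm (x - y)"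
    using F_class_lipschitz[OF assms(1,2)] by blast
  moreover have "solves_ivp a b \<eta> f (ivp_solution a b \<eta> f)"
    unfolding ivp_solution_def by (rule someI[of "solves_ivp a b \<eta> f"]) (rule assms(3))
  ultimately show ?thesis using solves_ivp_unique assms(3,4) by metis
qed

section \<open>Scalar equations and counting\<close>

text \<open>Separation of variables: \<open>T\<close> is the time as a function of the position, and
  \<open>s\<close> is its inverse. The bounds on \<open>q\<close> carry over to the slope of
  \<open>s\<close>.\<close>

lemma scalar_ode_solution:
  fixes q :: "real \<Rightarrow> real"
  assumes q: "continuous_on UNIV q" and "c1 > 0" and b: "\<And>x. c1 \<le> q x" "\<And>x. q x \<le> c2"
  obtains s where "s 0 = 0" "\<And>t. (s has_real_derivative q (s t)) (at t)"
    "\<And>t. t \<ge> 0 \<Longrightarrow> c1 * t \<le> s t" "\<And>t. t \<ge> 0 \<Longrightarrow> s t \<le> c2 * t"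
proof -
  have qpos: "0 < q x" for x using b(1)[of x] \<open>c1 > 0\<close> by linarith
  obtain T where T: "T 0 = 0" "\<And>x. (T has_real_derivative inverse (q x)) (at x)"
    by (rule continuous_antiderivative[of "\<lambda>x. inverse (q x)"])
      (use q qpos in \<open>auto intro!: continuous_intros simp: less_imp_neq[THEN not_sym]\<close>)
  have mono: "T x < T y" if "x < y" for x y
    by (rule DERIV_pos_imp_increasing[OF that]) (use T(2) qpos in \<open>metis inverse_positive_iff_positive\<close>)
  have cont: "continuous_on A T" for A
    using T(2) by (blast intro: continuous_at_imp_continuous_on DERIV_isCont)
  have c2: "c2 > 0" using b(2)[of 0] qpos[of 0] by linarith
  have "\<exists>y. T y = x" for x
  proof -
    \<comment> \<open>Since \<open>q\<close> is at most \<open>c2\<close>, the slope of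
      \<open>T\<close> is at least \<open>1 / c2\<close>; hence \<open>T\<close> is unbounded in
      both directions and, being continuous, surjective.\<close>
    have lower: "(y' - y) / c2 \<le> T y' - T y" if "y \<le> y'" for y y'
    proof -
      have "T y - y / c2 \<le> T y' - y' / c2"
      proof (rule DERIV_nonneg_imp_nondecreasing[OF that])
        fix x
        have "0 \<le> inverse (q x) - 1 / c2"
          using le_imp_inverse_le[OF b(2)[of x] qpos[of x]] by (simp add: inverse_eq_divide)
        then show "\<exists>d. ((\<lambda>y. T y - y / c2) has_real_derivative d) (at x) \<and> 0 \<le> d"
          by (intro exI[of _ "inverse (q x) - 1 / c2"]) (use c2 in \<open>auto intro!: derivative_eq_intros T(2)\<close>)
      qed
      then show ?thesis by (simp add: diff_divide_distrib)
    qed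
    define y where "y = c2 * (\<bar>x\<bar> + 1)"
    have "y > 0" using c2 by (auto simp: y_def intro!: mult_pos_pos)
    have "x \<le> T y" using lower[of 0 y] \<open>y > 0\<close> c2 by (simp add: y_def T(1))
    moreover have "T (- y) \<le> x" using lower[of "-y" 0] \<open>y > 0\<close> c2 by (simp add: y_def T(1))
    ultimately have "\<exists>x'\<ge>-y. x' \<le> y \<and> T x' = x"
      using \<open>y > 0\<close> by (intro IVT') (auto intro: cont)
    then show ?thesis by blast
  qed
  then obtain s where s: "\<And>x. T (s x) = x" by metis
  have sT: "s (T x) = x" for x
    by (metis mono linorder_neqE_linordered_idom less_irrefl s)
  have s0: "s 0 = 0" using sT[of 0] T(1) by simp
  have "isCont s (T (s t))" for t
    by (rule isCont_inverse_function[of 1]) (use sT T(2) in \<open>auto intro: DERIV_isCont\<close>)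
  then have "isCont s t" for t using s by simp
  then have ds: "(s has_real_derivative q (s t)) (at t)" for t
    using DERIV_inverse_function[of T "inverse (q (s t))" s t "t - 1" "t + 1"] T(2) qpos[of "s t"] s by auto
  have lo: "c1 * t \<le> s t" if "t \<ge> 0" for t
  proof -
    have "s 0 - c1 * 0 \<le> s t - c1 * t"
      by (rule DERIV_nonneg_imp_nondecreasing[OF that])
        (use b(1) in \<open>auto intro!: exI[of _ "q (s _) - c1"] derivative_eq_intros ds\<close>)
    then show ?thesis using s0 by simp
  qed
  have hi: "s t \<le> c2 * t" if "t \<ge> 0" for t
  proof -
    have "c2 * 0 - s 0 \<le> c2 * t - s t"
      by (rule DERIV_nonneg_imp_nondecreasing[OF that])
        (use b(2) in \<open>auto intro!: exI[of _ "c2 - q (s _)"] derivative_eq_intros ds\<close>)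
    then show ?thesis using s0 by simp
  qed
  show ?thesis using that s0 ds lo hi by blast
qed

text \<open>The derivative of \<open>s t - v * t - G (s t) / (2 * v)\<close> is \<open>g * (v - g) / (2 * v)\<close>, so a
  nonnegative perturbation \<open>g\<close> of the speed \<open>v\<close> gains at least \<open>G / (2 * v)\<close>.\<close>
lemma perturbation_gain:
  fixes s g G :: "real \<Rightarrow> real"
  assumes "v > 0" and ds: "\<And>t. (s has_real_derivative v + g (s t)) (at t)"
    and g: "\<And>x. x1 \<le> x \<Longrightarrow> x \<le> x2 \<Longrightarrow> 0 \<le> g x \<and> g x \<le> v"
    and G: "\<And>x. x1 \<le> x \<Longrightarrow> x \<le> x2 \<Longrightarrow> (G has_real_derivative g x) (at x)"
    and t: "t1 \<le> t2" "\<And>t. t1 \<le> t \<Longrightarrow> t \<le> t2 \<Longrightarrow> x1 \<le> s t \<and> s t \<le> x2"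
  shows "(G (s t2) - G (s t1)) / (2 * v) \<le> (s t2 - v * t2) - (s t1 - v * t1)"
proof -
  have "s t1 - v * t1 - G (s t1) / (2 * v) \<le> s t2 - v * t2 - G (s t2) / (2 * v)"
  proof (rule DERIV_nonneg_imp_nondecreasing[OF t(1)])
    fix t assume "t1 \<le> t" "t \<le> t2"
    then have r: "x1 \<le> s t" "s t \<le> x2" using t(2) by auto
    have d: "((\<lambda>t. s t - v * t - G (s t) / (2 * v)) has_real_derivative
       (v + g (s t)) - v - g (s t) * (v + g (s t)) / (2 * v)) (at t)"
      using \<open>v > 0\<close>
      by (auto intro!: derivative_eq_intros ds DERIV_chain2[OF G[OF r] ds] simp: field_simps)
    have "(v + g (s t)) - v - g (s t) * (v + g (s t)) / (2 * v) = g (s t) * (v - g (s t)) / (2 * v)"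
      using \<open>v > 0\<close> by (simp add: field_simps)
    also have "\<dots> \<ge> 0" using g[OF r] \<open>v > 0\<close> by auto
    finally show "\<exists>y. ((\<lambda>t. s t - v * t - G (s t) / (2 * v)) has_real_derivative y) (at t) \<and> 0 \<le> y"
      using d by blast
  qed
  then show ?thesis by (simp add: diff_divide_distrib)
qed

section \<open>Linear algebra and counting\<close>

lemma underdetermined_system:
  fixes A :: "nat \<Rightarrow> 'i \<Rightarrow> real"
  assumes "finite I" "n < card I"
  shows "\<exists>c. (\<exists>i\<in>I. c i \<noteq> 0) \<and> (\<forall>k<n. (\<Sum>i\<in>I. c i * A k i) = 0)"
  using assms
proof (induction n arbitrary: I A)
  case 0
  then have "I \<noteq> {}" by auto
  then show ?case by (intro exI[of _ "\<lambda>_. 1"]) auto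
next
  case (Suc n)
  show ?case
  proof (cases "\<forall>i\<in>I. A n i = 0")
    case True
    obtain c where "\<exists>i\<in>I. c i \<noteq> 0" "\<forall>k<n. (\<Sum>i\<in>I. c i * A k i) = 0"
      using Suc.IH[of I A] Suc.prems by auto
    then show ?thesis using True by (intro exI[of _ c]) (auto simp: less_Suc_eq)
  next
    case False
    \<comment> \<open>Gaussian elimination: equation \<open>n\<close> removes the unknown
      \<open>p\<close>, the reduced system has one equation and one unknown fewer, and
      \<open>c' p\<close> is then chosen so that equation \<open>n\<close> holds.\<close>
    then obtain p where p: "p \<in> I" "A n p \<noteq> 0" by auto
    define J where "J = I - {p}"
    have J: "finite J" "n < card J" using Suc.prems p by (auto simp: J_def)
    obtain c where c: "\<exists>i\<in>J. c i \<noteq> 0"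
      "\<And>k. k < n \<Longrightarrow> (\<Sum>i\<in>J. c i * (A k i - A k p * A n i / A n p)) = 0"
      using Suc.IH[OF J, of "\<lambda>k i. A k i - A k p * A n i / A n p"] by auto
    define c' where "c' = c(p := - (\<Sum>i\<in>J. c i * A n i) / A n p)"
    have split: "(\<Sum>i\<in>I. c' i * A k i) = c' p * A k p + (\<Sum>i\<in>J. c i * A k i)" for k
      unfolding J_def c'_def using p Suc.prems(1)
      by (subst sum.remove[of _ p]) (auto intro!: sum.cong)
    have "(\<Sum>i\<in>I. c' i * A k i) = 0" if "k < Suc n" for k
    proof (cases "k = n")
      case True
      then show ?thesis using p unfolding split by (simp add: c'_def)
    next
      case False
      have "(\<Sum>i\<in>J. c i * (A k i - A k p * A n i / A n p)) =
         (\<Sum>i\<in>J. c i * A k i) - (\<Sum>i\<in>J. c i * A n i) * (A k p / A n p)"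
        by (simp add: algebra_simps sum_subtractf sum_distrib_left sum_divide_distrib)
      then show ?thesis using c(2)[of k] False that unfolding split by (simp add: c'_def algebra_simps)
    qed
    moreover have "\<exists>i\<in>I. c' i \<noteq> 0" using c(1) by (auto simp: c'_def J_def)
    ultimately show ?thesis by blast
  qed
qed

text \<open>Division by an entry of maximal modulus. Entries of modulus at most 1 keep the
  perturbation in the function class; the entry 1 makes the solution feel it.\<close>

lemma underdetermined_system_normalised:
  fixes A :: "nat \<Rightarrow> 'i \<Rightarrow> real"
  assumes "finite I" "n < card I"
  obtains p c where "p \<in> I" "c p = 1" "\<And>i. i \<in> I \<Longrightarrow> \<bar>c i\<bar> \<le> 1"
    "\<And>k. k < n \<Longrightarrow> (\<Sum>i\<in>I. c i * A k i) = 0"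
proof -
  obtain c where c: "\<exists>i\<in>I. c i \<noteq> 0" "\<And>k. k < n \<Longrightarrow> (\<Sum>i\<in>I. c i * A k i) = 0"
    using underdetermined_system[OF assms, of A] by blast
  define m where "m = Max ((\<lambda>i. \<bar>c i\<bar>) ` I)"
  have fin: "finite ((\<lambda>i. \<bar>c i\<bar>) ` I)" using assms by auto
  have "m \<in> (\<lambda>i. \<bar>c i\<bar>) ` I" unfolding m_def using c(1) by (intro Max_in[OF fin]) auto
  then obtain p where p: "p \<in> I" "m = \<bar>c p\<bar>" by auto
  have le: "\<bar>c i\<bar> \<le> \<bar>c p\<bar>" if "i \<in> I" for i
    using that fin by (auto simp: m_def simp flip: p(2))
  have "c p \<noteq> 0" using c(1) le by fastforce
  show ?thesis
  proof (rule that[of p "\<lambda>i. c i / c p"])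
    show "(\<Sum>i\<in>I. c i / c p * A k i) = 0" if "k < n" for k
      using c(2)[OF that] by (simp flip: sum_divide_distrib)
  qed (use p le \<open>c p \<noteq> 0\<close> in \<open>auto simp: divide_le_eq\<close>)
qed

lemma card_PiE_UNIV:
  fixes S :: "'d::finite \<Rightarrow> nat set"
  assumes "\<And>l. finite (S l)"
  shows "finite {u. \<forall>l. u l \<in> S l}" "card {u. \<forall>l. u l \<in> S l} = (\<Prod>l\<in>UNIV. card (S l))"
proof -
  have "{u. \<forall>l. u l \<in> S l} = PiE UNIV S" by (auto simp: PiE_def Pi_def)
  then show "finite {u. \<forall>l. u l \<in> S l}" "card {u. \<forall>l. u l \<in> S l} = (\<Prod>l\<in>UNIV. card (S l))"
    using assms by (auto simp: card_PiE intro!: finite_PiE)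
qed

text \<open>Double counting. A bad block has more than half of its \<open>q\<close> positions in
  \<open>X\<close>, and \<open>pos\<close> is injective, so the bad blocks together hold at most
  \<open>2 * card X\<close> positions. The hypothesis leaves more than \<open>k\<close> good
  blocks.\<close>

lemma card_good_blocks:
  assumes "finite U" "finite X" and inj: "inj_on pos (U \<times> {..<q})"
    and c: "q * k + 2 * card X < card U * q"
  shows "k < card {u \<in> U. q \<le> 2 * card {p. p < q \<and> pos (u, p) \<notin> X}}"
proof -
  let ?f = "\<lambda>u. card {p. p < q \<and> pos (u, p) \<notin> X}" and ?b = "\<lambda>u. card {p. p < q \<and> pos (u, p) \<in> X}"
  let ?G = "{u \<in> U. q \<le> 2 * ?f u}" and ?B = "{u \<in> U. \<not> q \<le> 2 * ?f u}"
  have q: "?f u + ?b u = q" for u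
  proof -
    have "?f u + ?b u = card ({p. p < q \<and> pos (u, p) \<notin> X} \<union> {p. p < q \<and> pos (u, p) \<in> X})"
      by (rule card_Un_disjoint[symmetric]) auto
    also have "\<dots> = card {..<q}" by (rule arg_cong[of _ _ card]) auto
    finally show ?thesis by simp
  qed
  have "(\<Sum>u\<in>U. ?b u) = card (SIGMA u:U. {p. p < q \<and> pos (u, p) \<in> X})"
    using \<open>finite U\<close> by (subst card_SigmaI) auto
  also have "\<dots> \<le> card X"
    by (rule card_inj_on_le[of pos]) (use assms in \<open>auto intro: inj_on_subset\<close>)
  finally have s: "(\<Sum>u\<in>U. ?b u) \<le> card X" .
  have "card ?B * q = (\<Sum>u\<in>?B. q)" by simp
  also have "\<dots> \<le> (\<Sum>u\<in>?B. 2 * ?b u)"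
  proof (rule sum_mono)
    fix u assume "u \<in> ?B" then show "q \<le> 2 * ?b u" using q[of u] by auto
  qed
  also have "\<dots> \<le> (\<Sum>u\<in>U. 2 * ?b u)" using \<open>finite U\<close> by (intro sum_mono2) auto
  also have "\<dots> \<le> 2 * card X" using s by (simp flip: sum_distrib_left)
  finally have b: "card ?B * q \<le> 2 * card X" .
  have "card U = card (?G \<union> ?B)" by (rule arg_cong[of _ _ card]) auto
  also have "\<dots> = card ?G + card ?B" by (rule card_Un_disjoint) (use \<open>finite U\<close> in auto)
  finally have "card U * q = q * card ?G + card ?B * q" by (simp add: algebra_simps)
  with b c have "q * k < q * card ?G" by linarith
  then show ?thesis by simp
qed

section \<open>The steered flow\<close>

text \<open>For functions with disjoint supports: at each point at most one summand survives, so
  bounds do not grow with the number of cells.\<close>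

lemma abs_sum_le_single:
  fixes f :: "'i \<Rightarrow> real"
  assumes single: "\<And>i j. i \<in> S \<Longrightarrow> j \<in> S \<Longrightarrow> f i \<noteq> 0 \<Longrightarrow> f j \<noteq> 0 \<Longrightarrow> i = j"
    and B: "\<And>i. i \<in> S \<Longrightarrow> \<bar>f i\<bar> \<le> B" "0 \<le> B"
  shows "\<bar>sum f S\<bar> \<le> B"
proof (cases "finite S \<and> (\<exists>i\<in>S. f i \<noteq> 0)")
  case True
  then obtain i where i: "i \<in> S" "f i \<noteq> 0" by blast
  have "sum f S = sum f {i}"
    by (rule sum.mono_neutral_right) (use True i single in auto)
  then show ?thesis using B(1)[OF i(1)] by simp
next
  case False
  then have "sum f S = 0" by (cases "finite S") auto
  then show ?thesis using B(2) by simp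
qed

text \<open>\<open>plt\<close> is the cut-off at scale \<open>\<rho>\<close>, \<open>v\<close> the speed in direction \<open>i0\<close>, \<open>\<delta>\<close> the length of the
  steering phase, \<open>lam\<close> the side of the cube of cells and \<open>\<kappa>\<close> the amplitude of the bumps. The
  constants are to be chosen in this order: the derivatives of the steering field grow with
  \<open>1 / \<delta>\<close>, which a small lateral displacement (at most \<open>lam\<close>) compensates. The shifts are
  written as \<open>c * x + e\<close> to match the affine rules for \<^const>\<open>C_real\<close>.\<close>

locale steered_flow =
  fixes r :: nat and a b D :: real and M :: "(real^'d::finite) set" and \<eta> :: "real^'d" and i0 :: 'd
    and \<rho> v \<delta> lam \<kappa> K I :: real and plt P :: "real \<Rightarrow> real"
  assumes r: "r \<ge> 1" and ab: "a < b" and \<rho>: "\<rho> > 0" and v: "v > 0" and \<delta>: "\<delta> > 0"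
    and lam: "0 < lam" "lam \<le> 1" "lam \<le> \<delta>" "lam \<le> \<rho>" and \<kappa>: "0 < \<kappa>" "\<kappa> \<le> v / 2"
    and D: "D > 0"
    and plt: "plt \<in> C_real r" "\<And>x. \<bar>x\<bar> \<le> \<rho> \<Longrightarrow> plt x = 1" "\<And>x. 2 * \<rho> \<le> \<bar>x\<bar> \<Longrightarrow> plt x = 0"
    and I: "I > 0"
    and P: "\<And>x. (P has_real_derivative bump r x) (at x)" "\<And>x. x \<le> 0 \<Longrightarrow> P x = 0"
      "\<And>x. 1 \<le> x \<Longrightarrow> P x = I" "\<And>x. 0 \<le> P x \<and> P x \<le> I"
    and M: "\<And>x. (\<And>l. \<bar>x $ l - \<eta> $ l\<bar> < 2 * \<rho>) \<Longrightarrow> x \<in> M"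
    and speed: "2 * v * (b - a) \<le> \<rho>" and reach: "4 * \<delta> \<le> v * (b - a)" and \<delta>\<rho>: "\<delta> \<le> \<rho>"
    and K: "K \<ge> 1" "\<And>i x. i \<le> r \<Longrightarrow> \<bar>(deriv ^^ i) (bump r) x\<bar> \<le> K"
    and cell_amp: "\<kappa> / lam ^ r * K ^ CARD('d) \<le> D / 2"
    and chi_amp: "\<And>is y. length is \<le> r \<Longrightarrow>
      \<bar>v * iter_partial is (tensor (\<lambda>l x. plt (1 * x + - \<eta> $ l))) y\<bar> \<le> D / 2"
    and theta_amp: "\<And>is y. length is \<le> r \<Longrightarrow>
      \<bar>v * lam * iter_partial is (tensor (\<lambda>l. if l = i0
         then (\<lambda>x. 1 / (\<delta> * I) * bump r (1 / \<delta> * x + - \<eta> $ i0 / \<delta>))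
         else (\<lambda>x. plt (1 * x + - \<eta> $ l)))) y\<bar> \<le> D / 2"
begin

definition chi :: "real^'d \<Rightarrow> real" where
  "chi = tensor (\<lambda>l x. plt (1 * x + - \<eta> $ l))"

text \<open>In direction \<open>i0\<close> the factor is the derivative of the step
  \<open>P\<close>, stretched to length \<open>\<delta>\<close> and scaled to height 1; crossing it
  displaces the solution laterally by exactly \<open>disp\<close>.\<close>

definition theta :: "real^'d \<Rightarrow> real" where
  "theta = tensor (\<lambda>l. if l = i0
     then (\<lambda>x. 1 / (\<delta> * I) * bump r (1 / \<delta> * x + - \<eta> $ i0 / \<delta>))
     else (\<lambda>x. plt (1 * x + - \<eta> $ l)))"

text \<open>The cube of cells starts at distance \<open>\<delta>\<close> in direction
  \<open>i0\<close>, where the steering has just ended.\<close>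

definition corner :: "'d \<Rightarrow> real" where
  "corner l = \<eta> $ l + (if l = i0 then \<delta> else 0)"

definition cells :: "nat \<Rightarrow> ('d \<Rightarrow> nat) set" where
  "cells m = {J. \<forall>l. J l \<in> {..<m}}"

definition cell0 :: "nat \<Rightarrow> ('d \<Rightarrow> nat) \<Rightarrow> real^'d \<Rightarrow> real" where
  "cell0 m J = tensor (\<lambda>l x. bump r (m / lam * x + (- (m / lam * corner l) - J l)))"

definition cell :: "nat \<Rightarrow> ('d \<Rightarrow> nat) \<Rightarrow> real^'d \<Rightarrow> real" where
  "cell m J x = \<kappa> / m ^ r * cell0 m J x"

definition cellv :: "nat \<Rightarrow> ('d \<Rightarrow> nat) \<Rightarrow> real^'d \<Rightarrow> real^'d" where
  "cellv m J x = cell m J x *\<^sub>R axis i0 1"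

definition base :: "real^'d \<Rightarrow> real^'d \<Rightarrow> real^'d" where
  "base disp x = (v * chi x) *\<^sub>R axis i0 1 + (v * theta x) *\<^sub>R disp"

definition H :: "nat \<Rightarrow> (('d \<Rightarrow> nat) \<Rightarrow> real) \<Rightarrow> real^'d \<Rightarrow> real" where
  "H m C x = (\<Sum>J\<in>cells m. C J * cell m J x)"

definition field :: "nat \<Rightarrow> (('d \<Rightarrow> nat) \<Rightarrow> real) \<Rightarrow> real^'d \<Rightarrow> real^'d \<Rightarrow> real^'d" where
  "field m C disp x = base disp x + (\<Sum>J\<in>cells m. C J *\<^sub>R cellv m J x)"

definition admissible :: "real^'d \<Rightarrow> bool" where
  "admissible disp \<longleftrightarrow> disp $ i0 = 0 \<and> (\<forall>l. 0 \<le> disp $ l \<and> disp $ l \<le> lam)"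

lemma finite_cells: "finite (cells m)"
  unfolding cells_def by (rule card_PiE_UNIV) simp

lemma chi_C: "chi \<in> C_scalar r"
  unfolding chi_def by (intro tensor_C_scalar C_real_affine plt)

lemma theta_C: "theta \<in> C_scalar r"
  unfolding theta_def
  by (rule tensor_C_scalar, split if_split) (intro conjI impI C_real_mult C_real_const C_real_affine bump_C_real plt)

lemma cell0_factor_C: "(\<lambda>x. bump r (m / lam * x + (- (m / lam * corner l) - J))) \<in> C_real r"
  by (intro C_real_affine bump_C_real)

lemma cell0_C: "cell0 m J \<in> C_scalar r"
  unfolding cell0_def by (intro tensor_C_scalar cell0_factor_C)

lemma cell_C: "cell m J \<in> C_scalar r"
  unfolding cell_def[abs_def] by (intro C_scalar_cmult cell0_C)

lemma H_C: "H m C \<in> C_scalar r"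
  unfolding H_def[abs_def] by (intro C_scalar_sum C_scalar_cmult cell_C)

lemma cellv_nth: "cellv m J x $ j = (if j = i0 then cell m J x else 0)"
  by (simp add: cellv_def axis_def)

lemma cellv_C: "cellv m J \<in> C_vector r"
  unfolding C_vector_def
proof (intro CollectI allI)
  fix j show "(\<lambda>x. cellv m J x $ j) \<in> C_scalar r"
    by (cases "j = i0") (simp_all add: cellv_nth cell_C C_scalar_0)
qed

lemma field_nth:
  "admissible disp \<Longrightarrow> field m C disp x $ j = (if j = i0 then v * chi x + H m C x else v * disp $ j * theta x)"
  by (simp add: field_def base_def H_def axis_def admissible_def cellv_nth)

lemma field_C:
  assumes "admissible disp" shows "field m C disp \<in> C_vector r"
  unfolding C_vector_def
proof (intro CollectI allI)
  fix j show "(\<lambda>x. field m C disp x $ j) \<in> C_scalar r"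
    by (cases "j = i0") (simp_all add: field_nth[OF assms] C_scalar_add C_scalar_cmult chi_C theta_C H_C)
qed

text \<open>Transfers class membership and the explicit solution from \<open>field\<close> to the
  unperturbed field.\<close>

lemma base_eq_field: "base disp = field m (\<lambda>_. 0) disp"
  by (simp add: field_def fun_eq_iff)

section \<open>Derivatives of the cells and membership in the function class\<close>

lemma iter_partial_cell0:
  assumes "length is \<le> r"
  shows "iter_partial is (cell0 m J) y =
    (\<Prod>l\<in>UNIV. (m / lam) ^ count_list is l * (deriv ^^ count_list is l) (bump r) (m / lam * y $ l + (- (m / lam * corner l) - J l)))"
proof -
  have "count_list is l \<le> r" for l using assms count_le_length[of "is" l] by simp
  then show ?thesis unfolding cell0_def
    by (subst iter_partial_tensor[OF cell0_factor_C assms])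
      (intro prod.cong refl, subst deriv_pow_affine[OF bump_C_real], auto)
qed

text \<open>A nonvanishing derivative at \<open>y\<close> determines the cell, as its coordinates are the
  integer parts of the rescaled coordinates of \<open>y\<close>.\<close>
lemma iter_partial_cell_nonzero:
  assumes "length is \<le> r" "iter_partial is (cell m J) y \<noteq> 0"
  shows "int (J l) = \<lfloor>m / lam * (y $ l - corner l)\<rfloor>"
proof -
  have c: "count_list is l \<le> r" using assms count_le_length[of "is" l] by simp
  have "iter_partial is (cell0 m J) y \<noteq> 0"
    using assms iter_partial_cmult[OF cell0_C assms(1), of "\<kappa> / m ^ r" m J] unfolding cell_def[abs_def] by auto
  then have "(deriv ^^ count_list is l) (bump r) (m / lam * y $ l + (- (m / lam * corner l) - J l)) \<noteq> 0"
    unfolding iter_partial_cell0[OF assms(1)] by simp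
  then have "\<not> (m / lam * y $ l + (- (m / lam * corner l) - J l) \<le> 0 \<or> 1 \<le> m / lam * y $ l + (- (m / lam * corner l) - J l))"
    using deriv_pow_eq_0_outside[OF bump_C_real c bump_eq_0] by blast
  then show ?thesis by (intro floor_unique[symmetric]) (auto simp: algebra_simps diff_divide_distrib)
qed

lemma iter_partial_cell_unique:
  assumes "length is \<le> r" "iter_partial is (cell m J) y \<noteq> 0" "iter_partial is (cell m J') y \<noteq> 0"
  shows "J = J'"
proof
  fix l
  have "int (J l) = int (J' l)"
    using iter_partial_cell_nonzero[OF assms(1,2), of l] iter_partial_cell_nonzero[OF assms(1,3), of l] by simp
  then show "J l = J' l" by simp
qed

text \<open>Each differentiation costs a factor \<open>m / lam\<close>, which is at least 1, so
  order \<open>r\<close> is the worst case. The height \<open>\<kappa> / m ^ r\<close> then cancels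
  the dependence on \<open>m\<close>.\<close>

lemma iter_partial_cell_bound:
  assumes l: "length is \<le> r" and m: "m \<ge> 1"
  shows "\<bar>iter_partial is (cell m J) y\<bar> \<le> D / 2"
proof -
  have c: "count_list is l \<le> r" for l using l count_le_length[of "is" l] by simp
  have ml: "1 \<le> m / lam" using m lam by (simp add: field_simps)
  have "\<bar>iter_partial is (cell0 m J) y\<bar> \<le> (\<Prod>l\<in>(UNIV::'d set). (m / lam) ^ count_list is l * K)"
    unfolding iter_partial_cell0[OF l] abs_prod
    by (intro prod_mono conjI) (use K(2)[OF c] ml in \<open>auto simp: abs_mult intro!: mult_left_mono\<close>)
  also have "\<dots> = (m / lam) ^ length is * K ^ CARD('d)"
    by (simp add: prod.distrib sum_count_set flip: power_sum)
  also have "\<dots> \<le> (m / lam) ^ r * K ^ CARD('d)"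
    by (intro mult_right_mono power_increasing l ml) (use K in auto)
  finally have 1: "\<bar>iter_partial is (cell0 m J) y\<bar> \<le> (m / lam) ^ r * K ^ CARD('d)" .
  have "\<bar>iter_partial is (cell m J) y\<bar> = \<kappa> / m ^ r * \<bar>iter_partial is (cell0 m J) y\<bar>"
    using iter_partial_cmult[OF cell0_C l, of "\<kappa> / m ^ r" m J] \<kappa> unfolding cell_def[abs_def]
    by (simp add: abs_mult)
  also have "\<dots> \<le> \<kappa> / m ^ r * ((m / lam) ^ r * K ^ CARD('d))"
    by (intro mult_left_mono 1) (use \<kappa> in auto)
  also have "\<dots> = \<kappa> / lam ^ r * K ^ CARD('d)"
    using m by (simp add: power_divide)
  finally show ?thesis using cell_amp by linarith
qed

lemma iter_partial_H_bound:
  assumes "length is \<le> r" "m \<ge> 1" and C: "\<And>J. \<bar>C J\<bar> \<le> 1"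
  shows "\<bar>iter_partial is (H m C) y\<bar> \<le> D / 2"
proof -
  have "iter_partial is (H m C) y = (\<Sum>J\<in>cells m. C J * iter_partial is (cell m J) y)"
    unfolding H_def[abs_def]
    by (simp add: iter_partial_sum[OF C_scalar_cmult[OF cell_C] assms(1)] iter_partial_cmult[OF cell_C assms(1)])
  also have "\<bar>\<dots>\<bar> \<le> D / 2"
  proof (rule abs_sum_le_single)
    fix J
    have "\<bar>C J\<bar> * \<bar>iter_partial is (cell m J) y\<bar> \<le> 1 * (D / 2)"
      by (intro mult_mono C iter_partial_cell_bound assms) auto
    then show "\<bar>C J * iter_partial is (cell m J) y\<bar> \<le> D / 2" by (simp add: abs_mult)
  qed (use iter_partial_cell_unique[OF assms(1)] D in auto)
  finally show ?thesis .
qed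

lemma cell0_bounds: "0 \<le> cell0 m J x" "cell0 m J x \<le> 1"
  unfolding cell0_def by (auto intro!: prod_nonneg prod_le_1 bump_nonneg bump_le_1)

text \<open>Together with \<open>\<kappa> \<le> v / 2\<close> this keeps the speed of the perturbed
  solution above \<open>v / 2\<close>, as separation of variables requires.\<close>

lemma H_bound:
  assumes "m \<ge> 1" "\<And>J. \<bar>C J\<bar> \<le> 1"
  shows "\<bar>H m C y\<bar> \<le> \<kappa>"
  unfolding H_def
proof (rule abs_sum_le_single)
  fix J
  have "\<kappa> / m ^ r \<le> \<kappa>" using \<kappa> assms(1) by (simp add: field_simps)
  then have "\<bar>C J\<bar> * (\<kappa> / m ^ r * cell0 m J y) \<le> 1 * (\<kappa> * 1)"
    using \<kappa> assms(1) cell0_bounds by (intro mult_mono assms) auto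
  then show "\<bar>C J * cell m J y\<bar> \<le> \<kappa>" using \<kappa> cell0_bounds[of m J y] by (simp add: cell_def abs_mult)
qed (use iter_partial_cell_unique[of "[]"] \<kappa> in auto)

lemma outside_factor:
  assumes "x \<notin> M" obtains l where "2 * \<rho> \<le> \<bar>x $ l - \<eta> $ l\<bar>"
  using M[of x] assms that by (meson linorder_not_less)

lemma chi_outside: "x \<notin> M \<Longrightarrow> chi x = 0"
  by (erule outside_factor) (auto simp: chi_def prod_zero_iff intro!: plt(3))

lemma theta_outside: assumes "x \<notin> M" shows "theta x = 0"
proof -
  obtain l where l: "2 * \<rho> \<le> \<bar>x $ l - \<eta> $ l\<bar>" using outside_factor[OF assms] .
  have "x $ l / \<delta> - \<eta> $ l / \<delta> \<le> 0 \<or> 1 \<le> x $ l / \<delta> - \<eta> $ l / \<delta>"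
    using l \<delta>\<rho> \<delta> \<rho> unfolding diff_divide_distrib[symmetric] by (auto simp: field_simps)
  then have "bump r (x $ l / \<delta> - \<eta> $ l / \<delta>) = 0" by (rule bump_eq_0)
  then show ?thesis using l by (auto simp: theta_def prod_zero_iff plt(3) intro!: exI[of _ l])
qed

lemma cell_eq_0:
  assumes "m / lam * (x $ l - corner l) - J l \<le> 0 \<or> 1 \<le> m / lam * (x $ l - corner l) - J l"
  shows "cell m J x = 0"
proof -
  have "bump r (m / lam * x $ l + (- (m / lam * corner l) - J l)) = 0"
    by (rule bump_eq_0) (use assms in \<open>simp add: algebra_simps diff_divide_distrib\<close>)
  then have "cell0 m J x = 0" unfolding cell0_def by (auto simp: prod_zero_iff)
  then show ?thesis by (simp add: cell_def)
qed

lemma cell_outside: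
  assumes "x \<notin> M" "J \<in> cells m" shows "cell m J x = 0"
proof -
  obtain l where l: "2 * \<rho> \<le> \<bar>x $ l - \<eta> $ l\<bar>" using outside_factor[OF assms(1)] .
  have J: "real (J l) + 1 \<le> m" using assms(2) by (auto simp: cells_def Suc_leI dest!: spec[of _ l])
  \<comment> \<open>Measured from \<open>\<eta>\<close>, the cube ends at most at
    \<open>\<delta> + lam \<le> 2 * \<rho>\<close> in every coordinate, so a coordinate at distance
    \<open>2 * \<rho>\<close> misses it on one side.\<close>
  have "x $ l - corner l \<le> 0 \<or> lam \<le> x $ l - corner l"
    using l lam \<delta>\<rho> \<delta> \<rho> by (auto simp: corner_def)
  then show ?thesis
  proof
    assume "x $ l - corner l \<le> 0"
    then have "m / lam * (x $ l - corner l) \<le> 0" using lam by (intro mult_nonneg_nonpos) auto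
    then show ?thesis by (intro cell_eq_0[of m x l]) auto
  next
    assume "lam \<le> x $ l - corner l"
    then have "m / lam * lam \<le> m / lam * (x $ l - corner l)" using lam by (intro mult_left_mono) auto
    then show ?thesis using J lam by (intro cell_eq_0[of m x l]) auto
  qed
qed

lemma field_in_F_class:
  assumes "admissible disp" "m \<ge> 1" "\<And>J. \<bar>C J\<bar> \<le> 1"
  shows "field m C disp \<in> F_class r M D"
  unfolding F_class_def
proof (intro CollectI conjI allI impI)
  fix x assume "x \<notin> M"
  then have "H m C x = 0" by (auto simp: H_def cell_outside intro!: sum.neutral)
  then show "field m C disp x = 0" using \<open>x \<notin> M\<close>
    by (simp add: vec_eq_iff field_nth[OF assms(1)] chi_outside theta_outside)
next
  fix "is" :: "'d list" and j y assume l: "length is \<le> r"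
  show "\<bar>iter_partial is (\<lambda>x. field m C disp x $ j) y\<bar> \<le> D"
  proof (cases "j = i0")
    case True
    have "iter_partial is (\<lambda>x. field m C disp x $ j) y = v * iter_partial is chi y + iter_partial is (H m C) y"
      using True field_nth[OF assms(1)]
      by (simp add: iter_partial_add[OF C_scalar_cmult[OF chi_C] H_C l] iter_partial_cmult[OF chi_C l])
    moreover have "\<bar>v * iter_partial is chi y\<bar> \<le> D / 2"
      unfolding chi_def by (rule chi_amp[OF l])
    moreover have "\<bar>iter_partial is (H m C) y\<bar> \<le> D / 2"
      by (rule iter_partial_H_bound[OF l assms(2,3)])
    ultimately show ?thesis by linarith
  next
    case False
    have "iter_partial is (\<lambda>x. field m C disp x $ j) y = v * disp $ j * iter_partial is theta y"
      using False field_nth[OF assms(1)] by (simp add: iter_partial_cmult[OF theta_C l])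
    also have "\<bar>\<dots>\<bar> \<le> \<bar>v * lam * iter_partial is theta y\<bar>"
      using assms(1) v lam by (auto simp: abs_mult admissible_def intro!: mult_right_mono)
    also have "\<dots> \<le> D / 2" unfolding theta_def by (rule theta_amp[OF l])
    finally show ?thesis using D by simp
  qed
qed (rule field_C[OF assms(1)])

text \<open>\<open>path disp s\<close> is the curve followed by the steered solution; it agrees with \<open>ray disp s\<close> once
  \<open>s \<ge> \<delta>\<close>. Before that no cell is met, so along the curve the perturbation only depends on the
  point of the ray.\<close>
definition path :: "real^'d \<Rightarrow> real \<Rightarrow> real^'d" where
  "path disp s = \<eta> + s *\<^sub>R axis i0 1 + (P (s / \<delta>) / I) *\<^sub>R disp"

definition ray :: "real^'d \<Rightarrow> real \<Rightarrow> real^'d" where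
  "ray disp s = \<eta> + s *\<^sub>R axis i0 1 + disp"

lemma cell_before:
  assumes "x $ i0 \<le> \<eta> $ i0 + \<delta>" shows "cell m J x = 0"
proof -
  have "m / lam * (x $ i0 - corner i0) \<le> 0"
    using assms lam by (intro mult_nonneg_nonpos) (auto simp: corner_def)
  then show ?thesis by (intro cell_eq_0[of m x i0]) auto
qed

lemma H_before: "x $ i0 \<le> \<eta> $ i0 + \<delta> \<Longrightarrow> H m C x = 0"
  by (simp add: H_def cell_before)

text \<open>For \<open>s \<le> \<rho>\<close> the curve stays within \<open>\<rho>\<close> of
  \<open>\<eta>\<close> in every coordinate, where all plateau factors equal 1. The rest of the
  field depends on \<open>s\<close> alone; this is the reduction to a scalar equation.\<close>

lemma field_path:
  assumes adm: "admissible disp" and s: "0 \<le> s" "s \<le> \<rho>"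
  shows "field m C disp (path disp s) =
    (v + H m C (ray disp s)) *\<^sub>R axis i0 1 + (v * (bump r (s / \<delta>) / (\<delta> * I))) *\<^sub>R disp"
proof -
  have i0: "path disp s $ i0 = \<eta> $ i0 + s" "ray disp s $ i0 = \<eta> $ i0 + s"
    using adm by (auto simp: path_def ray_def admissible_def)
  have Pb: "0 \<le> P (s / \<delta>) / I" "P (s / \<delta>) / I \<le> 1" using P(4)[of "s / \<delta>"] I by auto
  have b: "\<bar>path disp s $ l - \<eta> $ l\<bar> \<le> \<rho>" for l
  proof (cases "l = i0")
    case False
    have d: "0 \<le> disp $ l" "disp $ l \<le> lam" using adm by (auto simp: admissible_def)
    have "P (s / \<delta>) / I * disp $ l \<le> 1 * lam"
      by (rule mult_mono) (use Pb d in auto)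
    moreover have "0 \<le> P (s / \<delta>) / I * disp $ l"
      by (rule mult_nonneg_nonneg) (use Pb d in auto)
    ultimately show ?thesis using False lam by (simp add: path_def axis_def)
  qed (use i0 s in auto)
  have chi: "chi (path disp s) = 1" using plt(2)[OF b] by (simp add: chi_def)
  have "theta (path disp s) = (\<Prod>l\<in>UNIV. if l = i0 then bump r (s / \<delta>) / (\<delta> * I) else 1)"
    unfolding theta_def
  proof (rule prod.cong[OF refl])
    fix l
    have "path disp s $ i0 / \<delta> - \<eta> $ i0 / \<delta> = s / \<delta>" by (simp add: i0 add_divide_distrib)
    then show "(if l = i0 then (\<lambda>x. 1 / (\<delta> * I) * bump r (1 / \<delta> * x + - \<eta> $ i0 / \<delta>))
         else (\<lambda>x. plt (1 * x + - \<eta> $ l))) (path disp s $ l) =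
        (if l = i0 then bump r (s / \<delta>) / (\<delta> * I) else 1)"
      using plt(2)[OF b[of l]] by auto
  qed
  then have theta: "theta (path disp s) = bump r (s / \<delta>) / (\<delta> * I)" by simp
  have H: "H m C (path disp s) = H m C (ray disp s)"
  proof (cases "s \<le> \<delta>")
    case True
    then show ?thesis using i0 by (simp add: H_before)
  next
    case False
    then have "P (s / \<delta>) = I" using \<delta> by (intro P) simp
    then have "path disp s = ray disp s" using I by (simp add: path_def ray_def)
    then show ?thesis by simp
  qed
  show ?thesis
    by (simp add: vec_eq_iff field_nth[OF adm] chi theta H) (use adm in \<open>auto simp: axis_def admissible_def\<close>)
qed

lemma path_solves_ivp:
  assumes adm: "admissible disp" and \<sigma>0: "\<sigma> 0 = 0"
    and d\<sigma>: "\<And>t. (\<sigma> has_real_derivative v + H m C (ray disp (\<sigma> t))) (at t)"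
    and \<sigma>: "\<And>t. 0 \<le> t \<Longrightarrow> t \<le> b - a \<Longrightarrow> 0 \<le> \<sigma> t \<and> \<sigma> t \<le> \<rho>"
  shows "solves_ivp a b \<eta> (field m C disp) (\<lambda>t. path disp (\<sigma> (t - a)))"
  unfolding solves_ivp_def
proof (intro conjI ballI)
  show "path disp (\<sigma> (a - a)) = \<eta>" by (simp add: \<sigma>0 path_def P)
next
  fix t assume t: "t \<in> {a..b}"
  let ?s = "\<sigma> (t - a)" and ?d = "v + H m C (ray disp (\<sigma> (t - a)))"
  have s: "0 \<le> ?s" "?s \<le> \<rho>" using \<sigma>[of "t - a"] t by auto
  have d: "((\<lambda>t. \<sigma> (t - a)) has_real_derivative ?d) (at t within {a..b})"
  proof -
    have "((\<lambda>t. \<sigma> (t - a)) has_real_derivative ?d * 1) (at t within {a..b})"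
      by (rule DERIV_chain2[OF d\<sigma>]) (auto intro!: derivative_eq_intros)
    then show ?thesis by simp
  qed
  have "((\<lambda>t. P (\<sigma> (t - a) / \<delta>)) has_real_derivative bump r (?s / \<delta>) * (?d / \<delta>)) (at t within {a..b})"
    by (rule DERIV_chain2[OF P(1)]) (rule DERIV_cdivide[OF d])
  then have dP: "((\<lambda>t. P (\<sigma> (t - a) / \<delta>) / I) has_real_derivative bump r (?s / \<delta>) * (?d / \<delta>) / I) (at t within {a..b})"
    by (rule DERIV_cdivide)
  \<comment> \<open>While the steering acts no cell is met and the speed is exactly
    \<open>v\<close>. So the chain rule for \<open>P (\<sigma> / \<delta>) / I\<close> yields the
    lateral velocity that the field prescribes, with factor \<open>v\<close> in place of
    \<open>?d\<close>.\<close>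
  have z: "bump r (?s / \<delta>) * H m C (ray disp ?s) = 0"
  proof (cases "?s \<le> \<delta>")
    case True
    then have "H m C (ray disp ?s) = 0"
      using adm by (intro H_before) (simp add: ray_def admissible_def)
    then show ?thesis by simp
  next
    case False
    then have "bump r (?s / \<delta>) = 0" using \<delta> by (intro bump_eq_0) simp
    then show ?thesis by simp
  qed
  have "((\<lambda>t. path disp (\<sigma> (t - a))) has_vector_derivative
      ?d *\<^sub>R axis i0 1 + (bump r (?s / \<delta>) * (?d / \<delta>) / I) *\<^sub>R disp) (at t within {a..b})"
    unfolding path_def
    using has_vector_derivative_add[OF has_vector_derivative_add[OF has_vector_derivative_const
        has_vector_derivative_scaleR[OF d has_vector_derivative_const]]
        has_vector_derivative_scaleR[OF dP has_vector_derivative_const], of \<eta> "axis i0 1" disp]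
    by simp
  moreover have "bump r (?s / \<delta>) * (?d / \<delta>) / I = v * (bump r (?s / \<delta>) / (\<delta> * I))"
    using z by (simp add: distrib_left mult_ac add_divide_distrib)
  ultimately show "((\<lambda>t. path disp (\<sigma> (t - a))) has_vector_derivative
      field m C disp (path disp ?s)) (at t within {a..b})"
    by (simp only: field_path[OF adm s])
qed

section \<open>The gain along a block of cells\<close>

definition column :: "nat \<Rightarrow> ('d \<Rightarrow> nat) \<Rightarrow> real^'d" where
  "column m u = (\<chi> l. if l = i0 then 0 else lam * (u l + 1/2) / m)"

text \<open>Along a ray through its centre a cell of coefficient 1 has integral \<open>\<kappa> / m
  ^ r * bump r (1/2) ^ (CARD('d) - 1) * (lam / m * I)\<close>. \<open>perturbation_gain\<close>
  divides this by \<open>2 * v\<close>, and the choice between entry and exit costs another factor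
  2.\<close>

definition amp :: real where
  "amp = \<kappa> * bump r (1/2) ^ (CARD('d) - 1) * lam * I / (4 * v)"

lemma amp_pos: "amp > 0"
  unfolding amp_def using \<kappa> lam I v bump_pos[of "1/2" r] by (intro divide_pos_pos mult_pos_pos) auto

lemma column_admissible:
  assumes "\<And>l. l \<noteq> i0 \<Longrightarrow> u l < m" shows "admissible (column m u)"
  unfolding admissible_def
proof (intro conjI allI)
  fix l
  have "real (u l) + 1 \<le> m" if "l \<noteq> i0" using assms[OF that] by linarith
  then show "column m u $ l \<le> lam" using lam
    by (auto simp: column_def divide_le_eq mult_le_cancel_left intro: ccontr)
  show "0 \<le> column m u $ l" using lam by (simp add: column_def)
qed (simp add: column_def)

text \<open>\<open>column\<close> aims at the lateral centres of the cells, so every lateral factor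
  is the constant \<open>bump r (1/2)\<close>.\<close>

lemma cell_on_ray:
  assumes "m \<ge> 1" and J: "\<And>l. l \<noteq> i0 \<Longrightarrow> J l = u l"
  shows "cell m J (ray (column m u) x) =
    \<kappa> / m ^ r * (bump r (m / lam * (x - \<delta>) - J i0) * bump r (1/2) ^ (CARD('d) - 1))"
proof -
  have "cell0 m J (ray (column m u) x) =
     bump r (m / lam * (x - \<delta>) - J i0) * (\<Prod>l\<in>UNIV - {i0}. bump r (1/2))"
    unfolding cell0_def
  proof (subst prod.remove[of UNIV i0], simp, simp, intro arg_cong2[of _ _ _ _ "(*)"] prod.cong refl)
    have "m / lam * ray (column m u) x $ i0 + (- (m / lam * corner i0) - J i0) = m / lam * (x - \<delta>) - J i0"
      by (simp add: ray_def column_def corner_def algebra_simps add_divide_distrib diff_divide_distrib)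
    then show "bump r (m / lam * ray (column m u) x $ i0 + (- (m / lam * corner i0) - J i0)) =
        bump r (m / lam * (x - \<delta>) - J i0)" by (rule arg_cong)
  next
    fix l assume "l \<in> UNIV - {i0}"
    then have "m / lam * ray (column m u) x $ l + (- (m / lam * corner l) - J l) = 1 / 2"
      using J[of l] lam \<open>m \<ge> 1\<close> by (simp add: ray_def column_def corner_def axis_def field_simps)
    then show "bump r (m / lam * ray (column m u) x $ l + (- (m / lam * corner l) - J l)) = bump r (1/2)" by (rule arg_cong)
  qed
  also have "(\<Prod>l\<in>UNIV - {i0}. bump r (1/2)) = bump r (1/2) ^ (CARD('d) - 1)"
    by (simp add: card_Diff_singleton)
  finally show ?thesis by (simp add: cell_def)
qed

lemma cell_off_ray:
  assumes "m \<ge> 1" "l \<noteq> i0" "J l \<noteq> u l"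
  shows "cell m J (ray (column m u) x) = 0"
proof (rule cell_eq_0[of _ _ l])
  have e: "m / lam * (ray (column m u) x $ l - corner l) = u l + 1/2"
    using assms(1,2) lam by (simp add: ray_def column_def corner_def axis_def field_simps)
  show "m / lam * (ray (column m u) x $ l - corner l) - J l \<le> 0 \<or>
        1 \<le> m / lam * (ray (column m u) x $ l - corner l) - J l"
    \<comment> \<open>For distinct integers \<open>u l\<close> and \<open>J l\<close>, the number
      \<open>u l + 1/2 - J l\<close> lies outside the unit interval.\<close>
    unfolding e using assms(3) by linarith
qed

text \<open>On this stretch of the ray the cells of other columns and of other blocks vanish, so the
  uncontrolled coefficients drop out of the sum.\<close>

lemma H_on_block:
  assumes m: "m = B * q" "m \<ge> 1" and u: "u i0 < B" "\<And>l. l \<noteq> i0 \<Longrightarrow> u l < m"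
    and x: "q * u i0 \<le> m / lam * (x - \<delta>)" "m / lam * (x - \<delta>) \<le> q * u i0 + q"
  shows "H m C (ray (column m u) x) = (\<Sum>p<q. C (u(i0 := q * u i0 + p)) *
    (\<kappa> / m ^ r * (bump r (m / lam * (x - \<delta>) - (q * u i0 + p)) * bump r (1/2) ^ (CARD('d) - 1))))"
proof -
  define blk where "blk p = u(i0 := q * u i0 + p)" for p
  have inj: "inj_on blk {..<q}" by (auto simp: inj_on_def blk_def dest!: fun_cong[of _ _ i0])
  have sub: "blk ` {..<q} \<subseteq> cells m"
  proof
    fix J assume "J \<in> blk ` {..<q}"
    then obtain p where p: "J = blk p" "p < q" by auto
    have "q * u i0 + p < q * (u i0 + 1)" using p by simp
    also have "\<dots> \<le> q * B" using u(1) by (intro mult_le_mono) auto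
    finally show "J \<in> cells m" using u(2) p m by (auto simp: cells_def blk_def mult.commute)
  qed
  have z: "C J * cell m J (ray (column m u) x) = 0" if "J \<in> cells m - blk ` {..<q}" for J
  proof (cases "\<forall>l. l \<noteq> i0 \<longrightarrow> J l = u l")
    case True
    have "\<not> (q * u i0 \<le> J i0 \<and> J i0 < q * u i0 + q)"
    proof
      assume "q * u i0 \<le> J i0 \<and> J i0 < q * u i0 + q"
      then have "J = blk (J i0 - q * u i0)" "J i0 - q * u i0 < q"
        using True by (auto simp: blk_def fun_eq_iff)
      then show False using that by auto
    qed
    then have "J i0 + 1 \<le> q * u i0 \<or> q * u i0 + q \<le> J i0" by linarith
    then have "real (J i0) + 1 \<le> q * u i0 \<or> real (q * u i0 + q) \<le> real (J i0)"
      by (metis of_nat_le_iff of_nat_1 of_nat_add)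
    then have "m / lam * (x - \<delta>) - J i0 \<le> 0 \<or> 1 \<le> m / lam * (x - \<delta>) - J i0"
      using x by auto
    then have "cell m J (ray (column m u) x) = 0"
      by (intro cell_eq_0[of m _ i0]) (simp add: ray_def column_def corner_def algebra_simps)
    then show ?thesis by simp
  next
    case False
    then show ?thesis using cell_off_ray[OF m(2)] by auto
  qed
  have "H m C (ray (column m u) x) = (\<Sum>J\<in>blk ` {..<q}. C J * cell m J (ray (column m u) x))"
    unfolding H_def by (rule sum.mono_neutral_right) (use finite_cells sub z in auto)
  also have "\<dots> = (\<Sum>p<q. C (blk p) * cell m (blk p) (ray (column m u) x))"
    by (simp add: sum.reindex[OF inj])
  also have "\<dots> = (\<Sum>p<q. C (blk p) *
    (\<kappa> / m ^ r * (bump r (m / lam * (x - \<delta>) - (q * u i0 + p)) * bump r (1/2) ^ (CARD('d) - 1))))"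
    by (intro sum.cong refl, subst cell_on_ray[OF m(2)]) (auto simp: blk_def)
  finally show ?thesis by (simp add: blk_def)
qed

text \<open>Signs are prescribed inside the block only. There the perturbation speeds the solution
  up, so \<open>\<sigma> t - v * t\<close> grows across the block by at least twice the claimed
  bound, whatever its value at entry.\<close>

lemma deviation:
  assumes m: "m = B * q" "m \<ge> 1" and u: "u i0 < B" "\<And>l. l \<noteq> i0 \<Longrightarrow> u l < m"
    and C: "\<And>J. \<bar>C J\<bar> \<le> 1" and nonneg: "\<And>p. p < q \<Longrightarrow> 0 \<le> C (u(i0 := q * u i0 + p))"
  obtains t where "t \<in> {a..b}"
    "amp / real m ^ Suc r * (\<Sum>p<q. C (u(i0 := q * u i0 + p))) \<le>
     infnorm (ivp_solution a b \<eta> (field m C (column m u)) t - ivp_solution a b \<eta> (base (column m u)) t)"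
proof -
  let ?disp = "column m u" and ?c = "\<lambda>p. C (u(i0 := q * u i0 + p))"
  define g where "g x = H m C (ray ?disp x)" for x
  have adm: "admissible ?disp" by (rule column_admissible) (rule u)
  have gb: "\<bar>g x\<bar> \<le> v / 2" for x unfolding g_def using H_bound[OF m(2) C] \<kappa> by (meson order_trans)
  have "continuous_on UNIV (iter_partial ([]::'d list) (H m C))"
    using H_C[of m C] unfolding C_scalar_def by (auto simp del: iter_partial.simps)
  then have "continuous_on UNIV (\<lambda>x. v + g x)" unfolding g_def ray_def
    by (auto intro!: continuous_intros continuous_on_compose2[of UNIV "H m C"])
  then obtain \<sigma> where \<sigma>: "\<sigma> 0 = 0" "\<And>t. (\<sigma> has_real_derivative v + g (\<sigma> t)) (at t)"
    "\<And>t. t \<ge> 0 \<Longrightarrow> v / 2 * t \<le> \<sigma> t" "\<And>t. t \<ge> 0 \<Longrightarrow> \<sigma> t \<le> 2 * v * t"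
  proof (rule scalar_ode_solution[where ?c1.0 = "v / 2" and ?c2.0 = "2 * v"])
    show "v / 2 \<le> v + g x" "v + g x \<le> 2 * v" for x using gb[of x] v by linarith+
  qed (use v in auto)
  have F1: "field m C ?disp \<in> F_class r M D" by (rule field_in_F_class[OF adm m(2) C])
  have F0: "base ?disp \<in> F_class r M D" unfolding base_eq_field[of _ m]
    by (rule field_in_F_class[OF adm m(2)]) simp
  have vt: "v * t \<le> \<rho> / 2" if "t \<le> b - a" for t
    using mult_left_mono[OF that, of v] v speed by linarith
  have z1: "ivp_solution a b \<eta> (field m C ?disp) t = path ?disp (\<sigma> (t - a))" if "t \<in> {a..b}" for t
  proof (rule ivp_solution_eq[OF F1 r _ that], rule path_solves_ivp[where \<sigma> = \<sigma>, OF adm \<sigma>(1)])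
    show "(\<sigma> has_real_derivative v + H m C (ray ?disp (\<sigma> t))) (at t)" for t
      using \<sigma>(2) by (simp add: g_def)
    show "0 \<le> \<sigma> t \<and> \<sigma> t \<le> \<rho>" if "0 \<le> t" "t \<le> b - a" for t
    proof -
      have "0 \<le> v / 2 * t" using v that by simp
      then show ?thesis using \<sigma>(3,4)[OF that(1)] vt[OF that(2)] by linarith
    qed
  qed
  have z0: "ivp_solution a b \<eta> (base ?disp) t = path ?disp (v * (t - a))" if "t \<in> {a..b}" for t
    unfolding base_eq_field[of _ m]
  proof (rule ivp_solution_eq[OF F0[unfolded base_eq_field[of _ m]] r _ that],
      rule path_solves_ivp[where \<sigma> = "(*) v", OF adm])
    show "((*) v has_real_derivative v + H m (\<lambda>_. 0) (ray ?disp (v * t))) (at t)" for t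
      by (auto simp: H_def intro!: derivative_eq_intros)
    show "0 \<le> v * t \<and> v * t \<le> \<rho>" if "0 \<le> t" "t \<le> b - a" for t
      using vt[OF that(2)] v that \<rho> by auto
  qed simp
  have mpos: "0 < real m" using m by simp
  define x1 where "x1 = \<delta> + lam * (q * u i0) / m"
  define x2 where "x2 = \<delta> + lam * (q * u i0 + q) / m"
  have x12: "0 \<le> x1" "x1 \<le> x2" unfolding x1_def x2_def using \<delta> lam mpos by (auto simp: field_simps)
  have "q * u i0 + q \<le> B * q" using u(1) by (metis Suc_leI mult.commute mult_Suc_right add.commute mult_le_mono2)
  then have "real (q * u i0 + q) \<le> m" using m by (simp only: of_nat_le_iff)
  then have "lam * (q * u i0 + q) \<le> lam * m" using lam by (intro mult_left_mono) auto
  then have "x2 \<le> \<delta> + lam" unfolding x2_def using mpos by (simp add: divide_le_eq)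
  \<comment> \<open>Even at the lowest speed \<open>v / 2\<close> the end of the block is reached in
    time, because \<open>\<delta> + lam \<le> 2 * \<delta>\<close> and \<open>reach\<close>
    holds.\<close>
  then have x2: "x2 \<le> v / 2 * (b - a)" using lam reach by simp
  have "\<exists>y. (\<sigma> has_real_derivative y) (at x) \<and> 0 \<le> y" for x
    using \<sigma>(2)[of x] gb[of "\<sigma> x"] v by (intro exI[of _ "v + g (\<sigma> x)"]) auto
  then have mono: "\<sigma> s \<le> \<sigma> t" if "s \<le> t" for s t
    by (intro DERIV_nonneg_imp_nondecreasing[OF that]) blast
  have cont: "continuous_on A \<sigma>" for A
    using \<sigma>(2) by (blast intro: continuous_at_imp_continuous_on DERIV_isCont)
  obtain t2 where t2: "0 \<le> t2" "t2 \<le> b - a" "\<sigma> t2 = x2"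
    using IVT'[of \<sigma> 0 x2 "b - a"] \<sigma>(1) \<sigma>(3)[of "b - a"] x2 x12 ab cont by auto
  obtain t1 where t1: "0 \<le> t1" "t1 \<le> t2" "\<sigma> t1 = x1"
    using IVT'[of \<sigma> 0 x1 t2] \<sigma>(1) t2 x12 cont by auto
  define e where "e p = \<kappa> / m ^ r * bump r (1/2) ^ (CARD('d) - 1) * ?c p" for p
  have block: "q * u i0 \<le> m / lam * (x - \<delta>) \<and> m / lam * (x - \<delta>) \<le> q * u i0 + q" if "x1 \<le> x" "x \<le> x2" for x
  proof -
    have "m / lam * (x1 - \<delta>) \<le> m / lam * (x - \<delta>)" "m / lam * (x - \<delta>) \<le> m / lam * (x2 - \<delta>)"
      using that lam by (auto intro!: mult_left_mono simp del: times_divide_eq_left)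
    moreover have "m / lam * (x1 - \<delta>) = q * u i0" "m / lam * (x2 - \<delta>) = q * u i0 + q"
      using lam mpos by (auto simp: x1_def x2_def)
    ultimately show ?thesis by linarith
  qed
  have g: "g x = (\<Sum>p<q. e p * bump r (m / lam * (x - \<delta>) - (q * u i0 + p)))" if "x1 \<le> x" "x \<le> x2" for x
    unfolding g_def e_def using block[OF that]
    by (subst H_on_block[where B = B and q = q and u = u, OF m u]) (auto simp: mult_ac)
  have e0: "0 \<le> e p" if "p < q" for p
    unfolding e_def using \<kappa> nonneg[OF that] by (auto intro!: mult_nonneg_nonneg zero_le_power bump_nonneg divide_nonneg_nonneg)
  \<comment> \<open>An explicit antiderivative of \<open>g\<close> over the block. Each term is 0 at
    \<open>x1\<close> and has collected the full mass of its bump at \<open>x2\<close>.\<close>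
  define G where "G x = (\<Sum>p<q. e p * (lam / m * P (m / lam * (x - \<delta>) - (q * u i0 + p))))" for x
  have G: "(G has_real_derivative g x) (at x)" if "x1 \<le> x" "x \<le> x2" for x
    unfolding g[OF that] G_def
  proof (rule DERIV_sum, rule DERIV_cmult)
    fix p
    have "((\<lambda>x. P (m / lam * (x - \<delta>) - (q * u i0 + p))) has_real_derivative
       bump r (m / lam * (x - \<delta>) - (q * u i0 + p)) * (m / lam)) (at x)"
      by (rule DERIV_chain2[OF P(1)]) (use lam in \<open>auto intro!: derivative_eq_intros\<close>)
    from DERIV_cmult[OF this, of "lam / m"]
    show "((\<lambda>x. lam / m * P (m / lam * (x - \<delta>) - (q * u i0 + p))) has_real_derivative
       bump r (m / lam * (x - \<delta>) - (q * u i0 + p))) (at x)"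
      using lam mpos by simp
  qed
  have G1: "G x1 = 0"
    unfolding G_def using block[of x1] x12 lam mpos by (intro sum.neutral) (auto simp: x1_def P(2))
  have G2: "G x2 = (\<Sum>p<q. e p * (lam / m * I))"
    unfolding G_def using lam mpos by (intro sum.cong refl) (auto simp: x2_def P(3))
  have "(G (\<sigma> t2) - G (\<sigma> t1)) / (2 * v) \<le> (\<sigma> t2 - v * t2) - (\<sigma> t1 - v * t1)"
  proof (rule perturbation_gain[OF v \<sigma>(2) _ G t1(2)])
    show "0 \<le> g x \<and> g x \<le> v" if "x1 \<le> x" "x \<le> x2" for x
    proof
      show "0 \<le> g x" unfolding g[OF that] by (intro sum_nonneg mult_nonneg_nonneg e0 bump_nonneg) auto
      show "g x \<le> v" using gb[of x] v by simp
    qed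
    show "x1 \<le> \<sigma> t \<and> \<sigma> t \<le> x2" if "t1 \<le> t" "t \<le> t2" for t
      using mono[OF that(1)] mono[OF that(2)] t1 t2 by simp
  qed auto
  moreover have "(G (\<sigma> t2) - G (\<sigma> t1)) / (2 * v) = 2 * (amp / real m ^ Suc r * (\<Sum>p<q. ?c p))"
    unfolding t1(3) t2(3) G1 G2 amp_def e_def
    by (simp add: sum_distrib_left sum_divide_distrib field_simps)
  \<comment> \<open>Two numbers that differ by at least twice a quantity cannot both have modulus
    below it.\<close>
  ultimately have "amp / real m ^ Suc r * (\<Sum>p<q. ?c p) \<le> \<bar>\<sigma> t1 - v * t1\<bar> \<or>
      amp / real m ^ Suc r * (\<Sum>p<q. ?c p) \<le> \<bar>\<sigma> t2 - v * t2\<bar>"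
    by linarith
  then obtain t where t: "t \<in> {t1, t2}" "amp / real m ^ Suc r * (\<Sum>p<q. ?c p) \<le> \<bar>\<sigma> t - v * t\<bar>"
    by blast
  have ta: "a + t \<in> {a..b}" using t t1 t2 by auto
  \<comment> \<open>Both solutions run along the same curve, parametrised by the coordinate
    \<open>i0\<close>, so this one component already shows the delay between them.\<close>
  have "\<bar>\<sigma> t - v * t\<bar> = \<bar>(path ?disp (\<sigma> t) - path ?disp (v * t)) \<bullet> axis i0 1\<bar>"
    by (simp add: path_def inner_axis column_def)
  also have "\<dots> \<le> infnorm (path ?disp (\<sigma> t) - path ?disp (v * t))"
    by (rule Basis_le_infnorm) simp
  also have "\<dots> = infnorm (ivp_solution a b \<eta> (field m C ?disp) (a + t) - ivp_solution a b \<eta> (base ?disp) (a + t))"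
    by (simp add: z0[OF ta] z1[OF ta])
  finally show ?thesis using t(2) by (intro that[OF ta]) linarith
qed

section \<open>The adversary argument\<close>

lemma standard_functional_detects_one_cell:
  assumes "standard_functional r L" "L (cellv m J) \<noteq> 0" "L (cellv m J') \<noteq> 0"
  shows "J = J'"
proof -
  obtain "is" i y where l: "length is \<le> r" and
    L: "\<And>f. f \<in> C_vector r \<Longrightarrow> L f = iter_partial is (\<lambda>x. f x $ i) y"
    using assms(1) by (auto simp: standard_functional_def)
  have e: "L (cellv m J) = (if i = i0 then iter_partial is (cell m J) y else 0)" for J
    using l by (simp add: L[OF cellv_C] cellv_nth iter_partial_0)
  show ?thesis using assms(2,3) iter_partial_cell_unique[OF l] unfolding e by (auto split: if_splits)
qed

text \<open>A block index \<open>u\<close> has the number of the block within its column at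
  \<open>i0\<close> and selects the column by its other coordinates; \<open>pos (u, p)\<close> is
  cell \<open>p\<close> of the block. The divisor 4 comes from two halves: only half of the block
  need be unseen, and one output must serve two solutions.\<close>

lemma error_lower_bound:
  assumes B: "B \<ge> 1" and q: "q \<ge> 1"
    and Lbars: "\<And>L. L \<in> set Lbars \<Longrightarrow> standard_functional r L"
    and Ls: "\<And>L. L \<in> set Ls \<Longrightarrow> linear_functional r L"
    and len: "q * length Ls + 2 * length Lbars < (B * q) ^ CARD('d)"
    and err: "worst_case_error a b \<eta> (F_class r M D) \<Phi> (Lbars @ Ls) \<le> ereal \<epsilon>"
  shows "amp / 4 * q / real (B * q) ^ Suc r \<le> \<epsilon>"
proof -
  define m where "m = B * q"
  have m: "m = B * q" "m \<ge> 1" using B q by (auto simp: m_def)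
  define U where "U = {u. \<forall>l. u l \<in> (if l = i0 then {..<B} else {..<m})}"
  define pos where "pos = (\<lambda>(u, p). u(i0 := q * u i0 + p) :: 'd \<Rightarrow> nat)"
  define X where "X = {J \<in> cells m. \<exists>L\<in>set Lbars. L (cellv m J) \<noteq> 0}"
  define G where "G = {u \<in> U. q \<le> 2 * card {p. p < q \<and> pos (u, p) \<notin> X}}"
  have "finite U" unfolding U_def by (rule card_PiE_UNIV) auto
  have "card U = (\<Prod>l\<in>(UNIV::'d set). card (if l = i0 then {..<B} else {..<m}))"
    unfolding U_def by (rule card_PiE_UNIV) auto
  also have "\<dots> = B * m ^ (CARD('d) - 1)"
    by (subst prod.remove[of _ i0]) (auto simp: card_Diff_singleton)
  finally have "card U * q = m * m ^ (CARD('d) - 1)" by (simp add: m_def)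
  then have cardU: "card U * q = m ^ CARD('d)" by (simp flip: power_Suc)
  \<comment> \<open>Division with remainder by \<open>q\<close> recovers the block and the position
    from a cell.\<close>
  have pos_inv: "(pos (u, p))(i0 := pos (u, p) i0 div q) = u" "pos (u, p) i0 mod q = p" if "p < q" for u p
    using that by (auto simp: pos_def)
  have inj: "inj_on pos (U \<times> {..<q})"
    by (rule inj_on_inverseI[of _ "\<lambda>J. (J(i0 := J i0 div q), J i0 mod q)"]) (use pos_inv in auto)
  have pos_cells: "pos (u, p) \<in> cells m" if "u \<in> U" "p < q" for u p
  proof -
    have u: "u i0 < B" "\<And>l. l \<noteq> i0 \<Longrightarrow> u l < m"
      using that(1) unfolding U_def by (auto split: if_splits dest: spec[of _ i0])
    have "q * u i0 + p < q * (u i0 + 1)" using that by simp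
    also have "\<dots> \<le> q * B" using u(1) by (intro mult_le_mono) auto
    finally show ?thesis using u(2) by (auto simp: cells_def pos_def m_def mult.commute)
  qed
  have Xfin: "finite X" using finite_cells by (simp add: X_def)
  have "X = (\<Union>L\<in>set Lbars. {J \<in> cells m. L (cellv m J) \<noteq> 0})" by (auto simp: X_def)
  also have "card \<dots> \<le> (\<Sum>L\<in>set Lbars. card {J \<in> cells m. L (cellv m J) \<noteq> 0})"
    by (rule card_UN_le) simp
  also have "\<dots> \<le> (\<Sum>L\<in>set Lbars. 1)"
  proof (rule sum_mono)
    fix L assume "L \<in> set Lbars"
    then have "\<And>J J'. L (cellv m J) \<noteq> 0 \<Longrightarrow> L (cellv m J') \<noteq> 0 \<Longrightarrow> J = J'"
      using standard_functional_detects_one_cell[OF Lbars] by blast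
    then show "card {J \<in> cells m. L (cellv m J) \<noteq> 0} \<le> 1"
      by (intro card_le_Suc0_iff_eq[THEN iffD2, unfolded One_nat_def[symmetric]]) (use finite_cells in auto)
  qed
  also have "\<dots> \<le> length Lbars" using card_length[of Lbars] by simp
  finally have "q * length Ls + 2 * card X < card U * q" using len cardU by (simp add: m_def)
  from card_good_blocks[OF \<open>finite U\<close> Xfin inj this]
  have nG: "length Ls < card G" by (simp add: G_def)
  have "finite G" using \<open>finite U\<close> by (simp add: G_def)
  \<comment> \<open>The unknowns are the good blocks: the entry is the value of the
    \<open>k\<close>-th linear functional on the sum of the unseen cells of block
    \<open>u\<close>.\<close>
  define A where "A k u = (\<Sum>p<q. if pos (u, p) \<notin> X then (Ls ! k) (cellv m (pos (u, p))) else 0)" for k u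
  obtain u0 c where u0: "u0 \<in> G" "c u0 = 1" and c: "\<And>u. u \<in> G \<Longrightarrow> \<bar>c u\<bar> \<le> 1"
    and ker: "\<And>k. k < length Ls \<Longrightarrow> (\<Sum>u\<in>G. c u * A k u) = 0"
    using underdetermined_system_normalised[OF \<open>finite G\<close> nG, of A] by blast
  \<comment> \<open>The kernel vector is spread as a constant over the unseen cells of each good
    block. Leaving out \<open>X\<close> makes every standard functional vanish on \<open>h\<close>,
    and the kernel property does the same for the others.\<close>
  define C where "C J = (if J \<notin> X \<and> J(i0 := J i0 div q) \<in> G then c (J(i0 := J i0 div q)) else 0)" for J
  have C1: "\<bar>C J\<bar> \<le> 1" for J using c by (simp add: C_def)
  have Cpos: "C (pos (u, p)) = (if pos (u, p) \<notin> X then c u else 0)" if "u \<in> G" "p < q" for u p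
    unfolding C_def pos_inv[OF that(2)] using that by simp
  have u0U: "u0 i0 < B" "\<And>l. l \<noteq> i0 \<Longrightarrow> u0 l < m"
    using u0(1) unfolding U_def G_def by (auto split: if_splits dest: spec[of _ i0])
  define h where "h x = (\<Sum>J\<in>cells m. C J *\<^sub>R cellv m J x)" for x
  have Lh: "L h = (\<Sum>J\<in>cells m. C J * L (cellv m J))" if "linear_functional r L" for L
    unfolding h_def[abs_def] by (rule linear_functional_sum[OF that cellv_C])
  have ann: "linear_functional r L \<and> L h = 0" if "L \<in> set (Lbars @ Ls)" for L
  proof (cases "L \<in> set Lbars")
    case True
    then have lin: "linear_functional r L" using Lbars standard_imp_linear_functional by blast
    have "C J * L (cellv m J) = 0" if "J \<in> cells m" for J
      using that True by (auto simp: C_def X_def)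
    then have "L h = 0" unfolding Lh[OF lin] by (intro sum.neutral) blast
    then show ?thesis using lin by simp
  next
    case False
    then have lin: "linear_functional r L" using that Ls by auto
    have "L \<in> set Ls" using False that by simp
    then obtain k where k: "k < length Ls" "L = Ls ! k" by (metis in_set_conv_nth)
    have sub: "pos ` (G \<times> {..<q}) \<subseteq> cells m" using pos_cells by (auto simp: G_def)
    have zero: "C J * L (cellv m J) = 0" if "J \<in> cells m - pos ` (G \<times> {..<q})" for J
    proof -
      have "J = pos (J(i0 := J i0 div q), J i0 mod q)" by (simp add: pos_def)
      moreover have "J i0 mod q < q" using q by simp
      ultimately have "J(i0 := J i0 div q) \<notin> G" using that by blast
      then show ?thesis by (simp add: C_def)
    qed
    have "L h = (\<Sum>J\<in>pos ` (G \<times> {..<q}). C J * L (cellv m J))"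
      unfolding Lh[OF lin] by (rule sum.mono_neutral_right) (use finite_cells sub zero in auto)
    also have "\<dots> = (\<Sum>(u, p)\<in>G \<times> {..<q}. C (pos (u, p)) * L (cellv m (pos (u, p))))"
      by (subst sum.reindex) (auto intro: inj_on_subset[OF inj] simp: G_def case_prod_unfold)
    also have "\<dots> = (\<Sum>u\<in>G. \<Sum>p<q. C (pos (u, p)) * L (cellv m (pos (u, p))))"
      by (simp add: sum.cartesian_product)
    also have "\<dots> = (\<Sum>u\<in>G. c u * (\<Sum>p<q. if pos (u, p) \<notin> X then L (cellv m (pos (u, p))) else 0))"
      unfolding sum_distrib_left by (intro sum.cong refl) (auto simp: Cpos)
    also have "\<dots> = 0" using ker[OF k(1)] unfolding A_def k(2)[symmetric] .
    finally show ?thesis using lin by simp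
  qed
  let ?disp = "column m u0"
  have adm: "admissible ?disp" by (rule column_admissible) (rule u0U)
  have F1: "field m C ?disp \<in> F_class r M D" by (rule field_in_F_class[OF adm m(2) C1])
  have F0: "base ?disp \<in> F_class r M D" unfolding base_eq_field[of _ m]
    by (rule field_in_F_class[OF adm m(2)]) simp
  have baseC: "base ?disp \<in> C_vector r" using F0 by (simp add: F_class_def)
  have hC: "h \<in> C_vector r" unfolding h_def[abs_def] by (intro C_vector_sum C_vector_scaleR cellv_C)
  have split: "field m C ?disp = (\<lambda>x. base ?disp x + h x)" by (simp add: field_def h_def fun_eq_iff)
  have "L (field m C ?disp) = L (base ?disp)" if "L \<in> set (Lbars @ Ls)" for L
    using ann[OF that] baseC hC unfolding split linear_functional_def by simp
  then have info: "information (Lbars @ Ls) (field m C ?disp) = information (Lbars @ Ls) (base ?disp)"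
    unfolding information_def by (intro map_cong refl)
  have C0: "C (u0(i0 := q * u0 i0 + p)) = (if pos (u0, p) \<notin> X then 1 else 0)" if "p < q" for p
    using Cpos[OF u0(1) that] u0(2) by (simp add: pos_def)
  obtain t where t: "t \<in> {a..b}" and dev:
    "amp / real m ^ Suc r * (\<Sum>p<q. C (u0(i0 := q * u0 i0 + p))) \<le>
     infnorm (ivp_solution a b \<eta> (field m C ?disp) t - ivp_solution a b \<eta> (base ?disp) t)"
    by (rule deviation[where u = u0 and C = C, OF m u0U C1]) (auto simp: C0)
  have "(\<Sum>p<q. C (u0(i0 := q * u0 i0 + p))) = card {p. p < q \<and> pos (u0, p) \<notin> X}"
    by (simp add: C0 sum.If_cases Int_def)
  also have "real (card {p. p < q \<and> pos (u0, p) \<notin> X}) \<ge> q / 2" using u0(1) by (simp add: G_def)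
  finally have half: "q / 2 \<le> (\<Sum>p<q. C (u0(i0 := q * u0 i0 + p)))" .
  let ?z1 = "ivp_solution a b \<eta> (field m C ?disp) t" and ?z0 = "ivp_solution a b \<eta> (base ?disp) t"
  \<comment> \<open>Equal information gives the same output \<open>?y\<close> for both fields; being
    within \<open>\<epsilon>\<close> of both solutions, it forces their distance to be at most
    \<open>2 * \<epsilon>\<close>.\<close>
  let ?y = "\<Phi> (information (Lbars @ Ls) (base ?disp)) t"
  have e: "infnorm (ivp_solution a b \<eta> f t - \<Phi> (information (Lbars @ Ls) f) t) \<le> \<epsilon>"
    if "f \<in> F_class r M D" for f
  proof -
    have "ereal (infnorm (ivp_solution a b \<eta> f t - \<Phi> (information (Lbars @ Ls) f) t))
      \<le> worst_case_error a b \<eta> (F_class r M D) \<Phi> (Lbars @ Ls)"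
      unfolding worst_case_error_def by (rule SUP_upper2[OF that], rule SUP_upper2[OF t]) simp
    with err show ?thesis by (metis ereal_less_eq(3) order_trans)
  qed
  have "infnorm (?z1 - ?z0) = infnorm ((?z1 - ?y) + (?y - ?z0))" by simp
  also have "\<dots> \<le> infnorm (?z1 - ?y) + infnorm (?y - ?z0)" by (rule infnorm_triangle)
  also have "\<dots> \<le> \<epsilon> + \<epsilon>"
    using e[OF F1] e[OF F0] info by (simp add: infnorm_sub)
  finally have "infnorm (?z1 - ?z0) \<le> 2 * \<epsilon>" by simp
  moreover have "amp / real m ^ Suc r * (q / 2) \<le> amp / real m ^ Suc r * (\<Sum>p<q. C (u0(i0 := q * u0 i0 + p)))"
    using amp_pos by (intro mult_left_mono half) auto
  ultimately have "amp / real m ^ Suc r * (q / 2) \<le> 2 * \<epsilon>" using dev by linarith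
  moreover have "amp / 4 * q / real m ^ Suc r = amp / real m ^ Suc r * (q / 2) / 2" by simp
  ultimately have "amp / 4 * q / real m ^ Suc r \<le> \<epsilon>"
    by (metis divide_right_mono nonzero_mult_div_cancel_left zero_le_numeral zero_neq_numeral)
  then show ?thesis by (simp only: m_def)
qed

end

section \<open>Rates\<close>

lemma tensor_derivs_bounded:
  fixes \<phi> :: "'d::finite \<Rightarrow> real \<Rightarrow> real"
  assumes C: "\<And>l. \<phi> l \<in> C_real r" and 0: "\<And>l x. x \<le> lo l \<or> hi l \<le> x \<Longrightarrow> \<phi> l x = 0"
  obtains K where "K > 0" "\<And>is y. length is \<le> r \<Longrightarrow> \<bar>iter_partial is (tensor \<phi>) y\<bar> \<le> K"
proof -
  have "\<exists>K\<ge>1. \<forall>i x. i \<le> r \<longrightarrow> \<bar>(deriv ^^ i) (\<phi> l) x\<bar> \<le> K" for l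
    by (rule C_real_derivs_bounded[where f = "\<phi> l", OF C 0]) blast+
  then obtain K where K: "\<And>l. K l \<ge> 1" "\<And>l i x. i \<le> r \<Longrightarrow> \<bar>(deriv ^^ i) (\<phi> l) x\<bar> \<le> K l" by metis
  have "\<bar>iter_partial is (tensor \<phi>) y\<bar> \<le> (\<Prod>l\<in>UNIV. K l)" if "length is \<le> r" for "is" y
  proof -
    have "count_list is l \<le> r" for l using that count_le_length[of "is" l] by simp
    then show ?thesis unfolding iter_partial_tensor[OF C that] abs_prod
      by (intro prod_mono conjI K) auto
  qed
  moreover have "(\<Prod>l\<in>UNIV. K l) > 0" using K(1) by (intro prod_pos) (meson less_le_trans zero_less_one)
  ultimately show ?thesis using that by blast
qed

lemma steered_flow_exists:
  fixes M :: "(real^'d::finite) set" and a b D :: real and i0 :: 'd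
  assumes r: "r \<ge> 1" and ab: "a < b" and D: "D > 0" and M: "open M" "\<eta> \<in> M"
  obtains \<rho> v \<delta> lam \<kappa> K I plt P where "steered_flow r a b D M \<eta> i0 \<rho> v \<delta> lam \<kappa> K I plt P"
proof -
  obtain e where e: "e > 0" "ball \<eta> e \<subseteq> M" using M open_contains_ball by blast
  \<comment> \<open>The open cube of half-side \<open>2 * \<rho>\<close> lies in the Euclidean ball,
    because its points have l1 distance at most \<open>e / 2\<close> from
    \<open>\<eta>\<close>.\<close>
  define \<rho> where "\<rho> = e / (4 * CARD('d))"
  have \<rho>: "\<rho> > 0" using e by (simp add: \<rho>_def)
  have inM: "x \<in> M" if "\<And>l. \<bar>x $ l - \<eta> $ l\<bar> < 2 * \<rho>" for x
  proof -
    have "dist x \<eta> \<le> (\<Sum>l\<in>UNIV. \<bar>(x - \<eta>) $ l\<bar>)" unfolding dist_norm by (rule norm_le_l1_cart)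
    also have "\<dots> \<le> (\<Sum>l\<in>(UNIV::'d set). 2 * \<rho>)" by (intro sum_mono) (use that in \<open>simp add: less_imp_le\<close>)
    also have "\<dots> = e / 2" by (simp add: \<rho>_def)
    finally have "x \<in> ball \<eta> e" using e by (simp add: dist_commute)
    then show ?thesis using e by blast
  qed
  obtain plt where plt: "plt \<in> C_real r" "\<And>x. \<bar>x\<bar> \<le> \<rho> \<Longrightarrow> plt x = 1" "\<And>x. 2 * \<rho> \<le> \<bar>x\<bar> \<Longrightarrow> plt x = 0"
    using plateau[OF \<rho>, of r] by blast
  obtain P I where P: "I > 0" "\<And>x. (P has_real_derivative bump r x) (at x)"
    "\<And>x. x \<le> 0 \<Longrightarrow> P x = 0" "\<And>x. 1 \<le> x \<Longrightarrow> P x = I" "\<And>x. 0 \<le> P x \<and> P x \<le> I"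
    using bump_antiderivative[of r] by metis
  obtain K where K: "K \<ge> 1" "\<And>i x. i \<le> r \<Longrightarrow> \<bar>(deriv ^^ i) (bump r) x\<bar> \<le> K"
    using C_real_derivs_bounded[OF bump_C_real bump_eq_0] by metis
  have pltC: "(\<lambda>x. plt (1 * x + - \<eta> $ l)) \<in> C_real r" for l by (rule C_real_affine[OF plt(1)])
  have plt0: "plt (1 * x + - \<eta> $ l) = 0" if "x \<le> \<eta> $ l - 2 * \<rho> \<or> \<eta> $ l + 2 * \<rho> \<le> x" for l x
    by (rule plt(3)) (use that in auto)
  obtain K1 where K1: "K1 > 0" "\<And>is y. length is \<le> r \<Longrightarrow>
      \<bar>iter_partial is (tensor (\<lambda>l x. plt (1 * x + - \<eta> $ l))) y\<bar> \<le> K1"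
    by (rule tensor_derivs_bounded[where \<phi> = "\<lambda>l x. plt (1 * x + - \<eta> $ l)" and
        lo = "\<lambda>l. \<eta> $ l - 2 * \<rho>" and hi = "\<lambda>l. \<eta> $ l + 2 * \<rho>", OF pltC plt0]) blast+
  define v where "v = min (D / (2 * K1)) (\<rho> / (2 * (b - a)))"
  have v: "v > 0" "v * K1 \<le> D / 2" "2 * v * (b - a) \<le> \<rho>"
  proof -
    show "v > 0" using K1 D \<rho> ab by (simp add: v_def)
    have "v * K1 \<le> D / (2 * K1) * K1" using K1 by (intro mult_right_mono) (auto simp: v_def)
    then show "v * K1 \<le> D / 2" using K1 by simp
    have "v * (2 * (b - a)) \<le> \<rho> / (2 * (b - a)) * (2 * (b - a))" using ab by (intro mult_right_mono) (auto simp: v_def)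
    then show "2 * v * (b - a) \<le> \<rho>" using ab by (simp add: mult_ac)
  qed
  define \<delta> where "\<delta> = v * (b - a) / 4"
  have \<delta>: "\<delta> > 0" "4 * \<delta> \<le> v * (b - a)" "\<delta> \<le> \<rho>" using v ab \<rho> by (auto simp: \<delta>_def)
  let ?th = "\<lambda>l. if l = i0 then (\<lambda>x. 1 / (\<delta> * I) * bump r (1 / \<delta> * x + - \<eta> $ i0 / \<delta>))
         else (\<lambda>x. plt (1 * x + - \<eta> $ l))"
  have thC: "?th l \<in> C_real r" for l
    by (split if_split) (intro conjI impI C_real_mult C_real_const C_real_affine bump_C_real plt)
  have th0: "?th l x = 0" if "x \<le> \<eta> $ l - 2 * \<rho> \<or> \<eta> $ l + 2 * \<rho> \<le> x" for l x
  proof (cases "l = i0")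
    case True
    have "(x - \<eta> $ l) / \<delta> \<le> 0 \<or> 1 \<le> (x - \<eta> $ l) / \<delta>"
      using that \<delta> \<rho> by (auto simp: divide_le_0_iff le_divide_eq)
    then have "bump r ((x - \<eta> $ l) / \<delta>) = 0" by (rule bump_eq_0)
    then show ?thesis using True by (simp add: diff_divide_distrib)
  qed (use plt0[OF that] in simp)
  obtain K2 where K2: "K2 > 0" "\<And>is y. length is \<le> r \<Longrightarrow> \<bar>iter_partial is (tensor ?th) y\<bar> \<le> K2"
    by (rule tensor_derivs_bounded[where \<phi> = ?th and
        lo = "\<lambda>l. \<eta> $ l - 2 * \<rho>" and hi = "\<lambda>l. \<eta> $ l + 2 * \<rho>", OF thC th0]) blast+
  define lam where "lam = min (min 1 \<delta>) (D / (2 * v * K2))"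
  have lam: "0 < lam" "lam \<le> 1" "lam \<le> \<delta>" "lam \<le> \<rho>" "v * lam * K2 \<le> D / 2"
  proof -
    show "0 < lam" using K2 D v \<delta> by (simp add: lam_def)
    show "lam \<le> 1" "lam \<le> \<delta>" by (auto simp: lam_def)
    then show "lam \<le> \<rho>" using \<delta> by simp
    have "lam * (v * K2) \<le> D / (2 * v * K2) * (v * K2)" using K2 v by (intro mult_right_mono) (auto simp: lam_def)
    then show "v * lam * K2 \<le> D / 2" using K2 v by (simp add: mult_ac)
  qed
  define \<kappa> where "\<kappa> = min (v / 2) (D / 2 * lam ^ r / K ^ CARD('d))"
  have Kp: "K ^ CARD('d) > 0" using K by (intro zero_less_power) simp
  have \<kappa>: "0 < \<kappa>" "\<kappa> \<le> v / 2" "\<kappa> / lam ^ r * K ^ CARD('d) \<le> D / 2"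
  proof -
    show "0 < \<kappa>" using v D lam Kp by (simp add: \<kappa>_def)
    show "\<kappa> \<le> v / 2" by (simp add: \<kappa>_def)
    have "\<kappa> * (K ^ CARD('d) / lam ^ r) \<le> D / 2 * lam ^ r / K ^ CARD('d) * (K ^ CARD('d) / lam ^ r)"
      using Kp lam by (intro mult_right_mono) (auto simp: \<kappa>_def)
    also have "\<dots> = D / 2" using K lam by simp
    finally show "\<kappa> / lam ^ r * K ^ CARD('d) \<le> D / 2" by simp
  qed
  have "steered_flow r a b D M \<eta> i0 \<rho> v \<delta> lam \<kappa> K I plt P"
  proof
    fix "is" :: "'d list" and y :: "real^'d" assume l: "length is \<le> r"
    let ?c = "iter_partial is (tensor (\<lambda>l x. plt (1 * x + - \<eta> $ l))) y"
    let ?t = "iter_partial is (tensor ?th) y"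
    have scale: "\<bar>c * x\<bar> \<le> c * k" if "\<bar>x\<bar> \<le> k" "0 \<le> c" for c x k :: real
      using that by (simp add: abs_mult mult_left_mono)
    have "\<bar>v * ?c\<bar> \<le> v * K1" by (rule scale[OF K1(2)[OF l]]) (use v in simp)
    then show "\<bar>v * ?c\<bar> \<le> D / 2" using v by linarith
    have "\<bar>v * lam * ?t\<bar> \<le> v * lam * K2" by (rule scale[OF K2(2)[OF l]]) (use v lam in simp)
    then show "\<bar>v * lam * ?t\<bar> \<le> D / 2" using lam by linarith
  qed (use r ab \<rho> v \<delta> lam \<kappa> D plt P K inM in auto)
  then show ?thesis using that by blast
qed

text \<open>Exports the bound from the locale: \<open>\<kappa>\<close> depends on the problem data
  but not on \<open>B\<close>, \<open>q\<close> or the information.\<close>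

lemma worst_case_error_lower_bound:
  fixes M :: "(real^'d::finite) set" and a b D :: real
  assumes "r \<ge> 1" "a < b" "D > 0" "open M" "\<eta> \<in> M"
  obtains \<kappa> where "\<kappa> > 0"
    "\<And>B q Lbars Ls \<Phi> \<epsilon>. B \<ge> 1 \<Longrightarrow> q \<ge> 1 \<Longrightarrow>
      (\<And>L. L \<in> set Lbars \<Longrightarrow> standard_functional r L) \<Longrightarrow>
      (\<And>L. L \<in> set Ls \<Longrightarrow> linear_functional r L) \<Longrightarrow>
      q * length Ls + 2 * length Lbars < (B * q) ^ CARD('d) \<Longrightarrow>
      worst_case_error a b \<eta> (F_class r M D) \<Phi> (Lbars @ Ls) \<le> ereal \<epsilon> \<Longrightarrow>
      \<kappa> * real q / real (B * q) ^ Suc r \<le> \<epsilon>"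
proof -
  \<comment> \<open>Any coordinate direction can serve as \<open>i0\<close>, hence
    \<open>undefined\<close>.\<close>
  obtain \<rho> v \<delta> lam \<kappa> K I plt P where "steered_flow r a b D M \<eta> undefined \<rho> v \<delta> lam \<kappa> K I plt P"
    using steered_flow_exists[OF assms] .
  then interpret steered_flow r a b D M \<eta> undefined \<rho> v \<delta> lam \<kappa> K I plt P .
  show ?thesis using that[of "amp / 4"] amp_pos error_lower_bound by force
qed

section \<open>From error bounds to complexity\<close>

lemma comp_nonad_geI:
  assumes "\<And>n Ls \<Phi>. n \<ge> 1 \<Longrightarrow> Ls \<in> \<N> n \<Longrightarrow> worst_case_error a b \<eta> F \<Phi> Ls \<le> ereal \<epsilon> \<Longrightarrow> X \<le> real n"
  shows "ereal X \<le> ereal_of_enat (comp_nonad a b \<eta> F \<N> \<epsilon>)"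
proof -
  let ?S = "{enat n | n. n \<ge> 1 \<and> (\<exists>Ls\<in>\<N> n. \<exists>\<Phi>. worst_case_error a b \<eta> F \<Phi> Ls \<le> ereal \<epsilon>)}"
  show ?thesis
  proof (cases "?S = {}")
    case True
    then show ?thesis unfolding comp_nonad_def True by (simp add: Inf_enat_def)
  next
    case False
    then have "Inf ?S \<in> ?S" unfolding Inf_enat_def using LeastI_ex[of "\<lambda>x. x \<in> ?S"] by auto
    then obtain n where "Inf ?S = enat n" "X \<le> real n" using assms by blast
    then show ?thesis unfolding comp_nonad_def by simp
  qed
qed

lemma rate_inversion:
  fixes c e \<epsilon> n :: real
  assumes "c > 0" "\<epsilon> > 0" "e > 0" "n > 0" and le: "c / n powr e \<le> \<epsilon>"
  shows "c powr (1 / e) * (1 / \<epsilon>) powr (1 / e) \<le> n"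
proof -
  have "c / \<epsilon> \<le> n powr e" using le assms by (simp add: field_simps)
  then have "(c / \<epsilon>) powr (1 / e) \<le> (n powr e) powr (1 / e)"
    using assms by (intro powr_mono2) auto
  also have "\<dots> = n" using assms by (simp add: powr_powr)
  finally show ?thesis using assms by (simp flip: powr_mult)
qed

text \<open>Rounding the root down and adding 1 gives strictly more than \<open>n\<close> cells; as
  the root is at least 1, this at most doubles it.\<close>

lemma nat_root_approx:
  fixes n p :: nat
  assumes "n \<ge> 1" "p \<ge> 1"
  obtains q where "q \<ge> 1" "n < q ^ p" "real q \<le> 2 * real n powr (1 / p)"
proof -
  let ?x = "real n powr (1 / p)"
  define q where "q = nat \<lfloor>?x\<rfloor> + 1"
  have x1: "1 \<le> ?x" using assms by (simp add: ge_one_powr_ge_zero)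
  have q: "?x < real q" "real q \<le> ?x + 1" unfolding q_def using x1 by linarith+
  have "real n = ?x ^ p" using assms by (simp add: powr_powr flip: powr_realpow)
  also have "\<dots> < real q ^ p" using q(1) assms by (intro power_strict_mono) auto
  finally have "n < q ^ p" by (simp flip: of_nat_power)
  moreover have "real q \<le> 2 * ?x" using q(2) x1 by linarith
  ultimately show ?thesis by (intro that[of q]) (auto simp: q_def)
qed

lemma inverse_power_rate:
  fixes n q p s :: nat
  assumes "q \<ge> 1" "n \<ge> 1" "p \<ge> 1" "c \<ge> 0" and q: "real q \<le> 2 * real n powr (1 / p)"
  shows "c / 2 ^ s / real n powr (s / p) \<le> c / real q ^ s"
proof -
  have "real q ^ s \<le> (2 * real n powr (1 / p)) ^ s" using q by (intro power_mono) auto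
  also have "\<dots> = 2 ^ s * real n powr (s / p)"
    using assms by (simp add: power_mult_distrib powr_powr flip: powr_realpow)
  finally have "c / (2 ^ s * real n powr (s / p)) \<le> c / real q ^ s"
    using assms by (intro divide_left_mono) auto
  then show ?thesis by simp
qed

text \<open>With \<open>q = 1\<close> and \<open>B ^ d > n\<close> the error is at least of order
  \<open>B ^ -(r + 1)\<close>, which yields the exponent \<open>d / (r + 1)\<close>. With
  \<open>B = 1\<close> and \<open>q ^ (d - 1) > n\<close> it is at least of order
  \<open>q ^ -r\<close>, which yields \<open>(d - 1) / r\<close>. The case split follows the larger
  exponent.\<close>

lemma comp_linear_info:
  fixes M :: "(real^'d::finite) set" and a b D :: real
  assumes "r \<ge> 1" "a < b" "D > 0" "open M" "\<eta> \<in> M"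
  shows "\<exists>C>0. \<forall>\<epsilon>>0. ereal (C * (1 / \<epsilon>) powr
          max ((real CARD('d) - 1) / real r) (real CARD('d) / (real r + 1)))
        \<le> ereal_of_enat (comp_nonad a b \<eta> (F_class r M D) (linear_info r) \<epsilon>)"
proof -
  let ?d = "CARD('d)"
  have d1: "?d \<ge> 1" by (simp add: Suc_leI)
  obtain \<kappa> where \<kappa>: "\<kappa> > 0" and lower:
    "\<And>B q Ls \<Phi> \<epsilon>. B \<ge> 1 \<Longrightarrow> q \<ge> 1 \<Longrightarrow>
      (\<And>L. L \<in> set Ls \<Longrightarrow> linear_functional r L) \<Longrightarrow> q * length Ls < (B * q) ^ ?d \<Longrightarrow>
      worst_case_error a b \<eta> (F_class r M D) \<Phi> Ls \<le> ereal \<epsilon> \<Longrightarrow>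
      \<kappa> * real q / real (B * q) ^ Suc r \<le> \<epsilon>"
    using worst_case_error_lower_bound[OF assms, of thesis]
    by (metis append_Nil empty_iff list.set(1) list.size(3) mult_0_right add_0_right)
  show ?thesis
  proof (cases "(real ?d - 1) / real r \<le> real ?d / (real r + 1)")
    case True
    define C where "C = (\<kappa> / 2 ^ Suc r) powr (?d / (real r + 1))"
    have "ereal (C * (1 / \<epsilon>) powr (?d / (real r + 1)))
        \<le> ereal_of_enat (comp_nonad a b \<eta> (F_class r M D) (linear_info r) \<epsilon>)" if \<epsilon>: "\<epsilon> > 0" for \<epsilon>
    proof (rule comp_nonad_geI)
      fix n Ls \<Phi>
      assume n: "n \<ge> 1" and Ls: "Ls \<in> linear_info r n"
        and err: "worst_case_error a b \<eta> (F_class r M D) \<Phi> Ls \<le> ereal \<epsilon>"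
      obtain B where B: "B \<ge> 1" "n < B ^ ?d" "real B \<le> 2 * real n powr (1 / ?d)"
        using nat_root_approx[OF n d1] .
      have "\<kappa> * real 1 / real (B * 1) ^ Suc r \<le> \<epsilon>"
        by (rule lower[OF _ _ _ _ err]) (use B Ls in \<open>auto simp: linear_info_def\<close>)
      then have "\<kappa> / real B ^ Suc r \<le> \<epsilon>" by (simp only: mult_1_right of_nat_1)
      then have "\<kappa> / 2 ^ Suc r / real n powr (Suc r / ?d) \<le> \<epsilon>"
        using inverse_power_rate[OF B(1) n d1 _ B(3), of \<kappa> "Suc r"] \<kappa> by linarith
      from rate_inversion[OF _ \<epsilon> _ _ this] show "C * (1 / \<epsilon>) powr (?d / (real r + 1)) \<le> real n"
        using \<kappa> n d1 by (simp add: C_def add.commute)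
    qed
    moreover have "C > 0" using \<kappa> by (simp add: C_def)
    ultimately show ?thesis using True by (auto simp: max_absorb2)
  next
    case False
    \<comment> \<open>Here the first exponent is positive, so the dimension is at least 2 and a root
      of order \<open>d - 1\<close> makes sense.\<close>
    have "0 \<le> real ?d / (real r + 1)" by simp
    with False have "0 < (real ?d - 1) / real r" by linarith
    then have "real ?d - 1 > 0" by (auto simp: zero_less_divide_iff)
    then have d2: "?d - 1 \<ge> 1" "real (?d - 1) = real ?d - 1" by auto
    define C where "C = (\<kappa> / 2 ^ r) powr ((real ?d - 1) / r)"
    have "ereal (C * (1 / \<epsilon>) powr ((real ?d - 1) / r))
        \<le> ereal_of_enat (comp_nonad a b \<eta> (F_class r M D) (linear_info r) \<epsilon>)" if \<epsilon>: "\<epsilon> > 0" for \<epsilon>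
    proof (rule comp_nonad_geI)
      fix n Ls \<Phi>
      assume n: "n \<ge> 1" and Ls: "Ls \<in> linear_info r n"
        and err: "worst_case_error a b \<eta> (F_class r M D) \<Phi> Ls \<le> ereal \<epsilon>"
      obtain q where q: "q \<ge> 1" "n < q ^ (?d - 1)" "real q \<le> 2 * real n powr (1 / real (?d - 1))"
        using nat_root_approx[OF n d2(1)] .
      have "q * n < q * q ^ (?d - 1)" using q by simp
      also have "\<dots> = q ^ ?d" using d1 by (simp flip: power_Suc)
      finally have "\<kappa> * real q / real (1 * q) ^ Suc r \<le> \<epsilon>"
        by (intro lower[OF _ _ _ _ err]) (use q Ls in \<open>auto simp: linear_info_def\<close>)
      then have "\<kappa> / real q ^ r \<le> \<epsilon>" using q by simp
      then have "\<kappa> / 2 ^ r / real n powr (r / real (?d - 1)) \<le> \<epsilon>"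
        using inverse_power_rate[OF q(1) n d2(1) _ q(3), of \<kappa> r] \<kappa> by linarith
      from rate_inversion[OF _ \<epsilon> _ _ this] show "C * (1 / \<epsilon>) powr ((real ?d - 1) / r) \<le> real n"
        using \<kappa> n d2 assms(1) by (simp add: C_def)
    qed
    moreover have "C > 0" using \<kappa> by (simp add: C_def)
    ultimately show ?thesis using False by (auto simp: max_absorb1)
  qed
qed

text \<open>\<open>C\<close> and \<open>\<epsilon>0\<close> are fixed from \<open>\<alpha>\<close>,
  \<open>n0\<close> and the problem data before \<open>k\<close> is given, which makes the bound
  uniform in \<open>k\<close>.\<close>

lemma comp_mixed_info:
  fixes M :: "(real^'d::finite) set" and a b D \<alpha> :: real
  assumes "r \<ge> 1" "a < b" "D > 0" "open M" "\<eta> \<in> M" and \<alpha>: "\<alpha> > 0" and n0: "n0 \<ge> 1"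
  shows "\<exists>C>0. \<exists>\<epsilon>0>0. \<forall>k::nat \<Rightarrow> nat.
           (\<forall>n\<ge>n0. real (k n) \<le> \<alpha> * real n powr (1 - 1 / real CARD('d))) \<longrightarrow>
           (\<forall>\<epsilon>. 0 < \<epsilon> \<and> \<epsilon> \<le> \<epsilon>0 \<longrightarrow>
              ereal (C * (1 / \<epsilon>) powr (real CARD('d) / real r))
              \<le> ereal_of_enat (comp_nonad a b \<eta> (F_class r M D) (mixed_info r k) \<epsilon>))"
proof -
  let ?d = "CARD('d)"
  have d1: "?d \<ge> 1" by (simp add: Suc_leI)
  obtain \<kappa> where \<kappa>: "\<kappa> > 0" and lower:
    "\<And>B q Lbars Ls \<Phi> \<epsilon>. B \<ge> 1 \<Longrightarrow> q \<ge> 1 \<Longrightarrow>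
      (\<And>L. L \<in> set Lbars \<Longrightarrow> standard_functional r L) \<Longrightarrow>
      (\<And>L. L \<in> set Ls \<Longrightarrow> linear_functional r L) \<Longrightarrow>
      q * length Ls + 2 * length Lbars < (B * q) ^ ?d \<Longrightarrow>
      worst_case_error a b \<eta> (F_class r M D) \<Phi> (Lbars @ Ls) \<le> ereal \<epsilon> \<Longrightarrow>
      \<kappa> * real q / real (B * q) ^ Suc r \<le> \<epsilon>"
    using worst_case_error_lower_bound[OF assms(1-5)] by blast
  \<comment> \<open>For \<open>q\<close> of order \<open>n powr (1 / d)\<close> the growth condition
    gives \<open>q * k n \<le> \<alpha> * q ^ d\<close>, and the standard functionals add at most
    \<open>2 * q ^ d\<close>. So \<open>B > \<alpha> + 2\<close> is what the counting needs.\<close>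
  define B where "B = nat \<lceil>\<alpha>\<rceil> + 3"
  have B: "B \<ge> 1" "\<alpha> + 2 < real B" unfolding B_def by linarith+
  \<comment> \<open>Half of the error that fewer than \<open>n0\<close> functionals cannot avoid.
    Accuracy \<open>\<epsilon>0\<close> thus forces \<open>n \<ge> n0\<close>, the range in which
    the growth of \<open>k\<close> is controlled.\<close>
  define \<epsilon>0 where "\<epsilon>0 = \<kappa> / real n0 ^ Suc r / 2"
  define c where "c = \<kappa> / real B ^ Suc r"
  define C where "C = (c / 2 ^ r) powr (?d / r)"
  have pos: "\<epsilon>0 > 0" "c > 0" "C > 0" using \<kappa> n0 B by (auto simp: \<epsilon>0_def c_def C_def)
  have "ereal (C * (1 / \<epsilon>) powr (real ?d / real r))
      \<le> ereal_of_enat (comp_nonad a b \<eta> (F_class r M D) (mixed_info r k) \<epsilon>)"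
    if k: "\<And>n. n \<ge> n0 \<Longrightarrow> real (k n) \<le> \<alpha> * real n powr (1 - 1 / real ?d)" and \<epsilon>: "0 < \<epsilon>" "\<epsilon> \<le> \<epsilon>0" for k \<epsilon>
  proof (rule comp_nonad_geI)
    fix n and Lall :: "'d functional list" and \<Phi>
    assume n: "n \<ge> 1" and L: "Lall \<in> mixed_info r k n"
      and err: "worst_case_error a b \<eta> (F_class r M D) \<Phi> Lall \<le> ereal \<epsilon>"
    obtain Lbars Ls where Ls: "Lall = Lbars @ Ls" "n \<ge> k n + 1" "length Lbars = n - k n" "length Ls = k n"
      "\<And>L. L \<in> set Lbars \<Longrightarrow> standard_functional r L" "\<And>L. L \<in> set Ls \<Longrightarrow> linear_functional r L"
      using L by (auto simp: mixed_info_def)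
    have "n \<ge> n0"
    proof (rule ccontr)
      assume "\<not> n \<ge> n0"
      moreover have "n0 ^ 1 \<le> n0 ^ ?d" using n0 d1 by (intro power_increasing) auto
      \<comment> \<open>For small \<open>n\<close> nothing bounds \<open>k n\<close>, so all
        functionals are treated as merely linear, with \<open>n0 ^ d\<close> blocks of a single
        cell.\<close>
      ultimately have "1 * length (Lbars @ Ls) + 2 * length ([] :: 'd functional list) < (n0 * 1) ^ ?d"
        using Ls by simp
      then have "\<kappa> * real 1 / real (n0 * 1) ^ Suc r \<le> \<epsilon>"
        by (rule lower[of n0 1 "[]" "Lbars @ Ls", rotated 4])
          (use err Ls n0 standard_imp_linear_functional in auto)
      then have "2 * \<epsilon>0 \<le> \<epsilon>" by (simp add: \<epsilon>0_def)
      with pos \<epsilon> show False by linarith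
    qed
    obtain q where q: "q \<ge> 1" "n < q ^ ?d" "real q \<le> 2 * real n powr (1 / ?d)"
      using nat_root_approx[OF n d1] .
    have nq: "real n \<le> real q ^ ?d" using q(2) by (metis less_imp_le of_nat_le_iff of_nat_power)
    have "real n powr (1 - 1 / ?d) \<le> (real q ^ ?d) powr (1 - 1 / ?d)"
      using nq d1 by (intro powr_mono2) auto
    also have "\<dots> = real q ^ (?d - 1)"
    proof -
      have "real ?d * (1 - 1 / ?d) = real (?d - 1)" using d1 by (simp add: right_diff_distrib of_nat_diff)
      then show ?thesis using q by (simp add: powr_powr flip: powr_realpow)
    qed
    finally have "\<alpha> * real n powr (1 - 1 / ?d) \<le> \<alpha> * real q ^ (?d - 1)" using \<alpha> by simp
    with k[OF \<open>n \<ge> n0\<close>] have kq: "real (k n) \<le> \<alpha> * real q ^ (?d - 1)" by linarith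
    have "real q * real (k n) \<le> real q * (\<alpha> * real q ^ (?d - 1))" by (intro mult_left_mono kq) simp
    also have "\<dots> = \<alpha> * real q ^ ?d" using d1 by (simp add: mult.left_commute flip: power_Suc)
    finally have "real q * real (length Ls) \<le> \<alpha> * real q ^ ?d" using Ls(4) by simp
    moreover have "real (length Lbars) \<le> real q ^ ?d" using nq Ls(3) by simp
    moreover have "real (q * length Ls + 2 * length Lbars) = real q * real (length Ls) + 2 * real (length Lbars)"
      by simp
    ultimately have "real (q * length Ls + 2 * length Lbars) \<le> (\<alpha> + 2) * real q ^ ?d"
      unfolding distrib_right by linarith
    also have "\<dots> < real B * real q ^ ?d" using B q by (intro mult_strict_right_mono) auto
    also have "\<dots> \<le> real B ^ ?d * real q ^ ?d"
      using power_increasing[of 1 ?d "real B"] B d1 by (intro mult_right_mono) auto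
    also have "\<dots> = real ((B * q) ^ ?d)" by (simp add: power_mult_distrib)
    finally have "q * length Ls + 2 * length Lbars < (B * q) ^ ?d" by (simp only: of_nat_less_iff)
    then have "\<kappa> * real q / real (B * q) ^ Suc r \<le> \<epsilon>"
      using lower[OF B(1) q(1) Ls(5,6)] err Ls(1) by blast
    moreover have "\<kappa> * real q / real (B * q) ^ Suc r = c / real q ^ r"
      using q B by (simp add: c_def power_mult_distrib)
    ultimately have "c / 2 ^ r / real n powr (r / ?d) \<le> \<epsilon>"
      using inverse_power_rate[OF q(1) n d1 _ q(3), of c r] pos by linarith
    from rate_inversion[OF _ \<epsilon>(1) _ _ this] show "C * (1 / \<epsilon>) powr (?d / r) \<le> real n"
      using pos n d1 assms(1) by (simp add: C_def)
  qed
  with pos show ?thesis by blast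
qed

theorem theorem2:
  fixes r :: nat and a b D :: real and M :: "(real^'d::finite) set" and \<eta> :: "real^'d"
  assumes "r \<ge> 1" and "a < b" and "D > 0" and "open M" and "\<eta> \<in> M"
  shows
    "(\<exists>C>0. \<exists>\<epsilon>0>0. \<forall>\<epsilon>. 0 < \<epsilon> \<and> \<epsilon> \<le> \<epsilon>0 \<longrightarrow>
        ereal (C * (1 / \<epsilon>) powr
          max ((real CARD('d) - 1) / real r) (real CARD('d) / (real r + 1)))
        \<le> ereal_of_enat (comp_nonad a b \<eta> (F_class r M D) (linear_info r) \<epsilon>))
     \<and>
     (\<forall>\<alpha>::real. \<forall>n0::nat. \<alpha> > 0 \<and> n0 \<ge> 1 \<longrightarrow>
        (\<exists>C>0. \<exists>\<epsilon>0>0. \<forall>k::nat \<Rightarrow> nat.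
           (\<forall>n\<ge>1. k n \<ge> 1) \<and>
           (\<forall>n\<ge>n0. real (k n) \<le> \<alpha> * real n powr (1 - 1 / real CARD('d))) \<longrightarrow>
           (\<forall>\<epsilon>. 0 < \<epsilon> \<and> \<epsilon> \<le> \<epsilon>0 \<longrightarrow>
              ereal (C * (1 / \<epsilon>) powr (real CARD('d) / real r))
              \<le> ereal_of_enat (comp_nonad a b \<eta> (F_class r M D) (mixed_info r k) \<epsilon>))))"
proof (intro conjI allI impI)
  from comp_linear_info[OF assms]
  show "\<exists>C>0. \<exists>\<epsilon>0>0. \<forall>\<epsilon>. 0 < \<epsilon> \<and> \<epsilon> \<le> \<epsilon>0 \<longrightarrow>
        ereal (C * (1 / \<epsilon>) powr
          max ((real CARD('d) - 1) / real r) (real CARD('d) / (real r + 1)))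
        \<le> ereal_of_enat (comp_nonad a b \<eta> (F_class r M D) (linear_info r) \<epsilon>)"
    using zero_less_one by blast
next
  fix \<alpha> :: real and n0 :: nat assume "\<alpha> > 0 \<and> n0 \<ge> 1"
  with comp_mixed_info[OF assms, of \<alpha> n0]
  show "\<exists>C>0. \<exists>\<epsilon>0>0. \<forall>k::nat \<Rightarrow> nat.
           (\<forall>n\<ge>1. k n \<ge> 1) \<and>
           (\<forall>n\<ge>n0. real (k n) \<le> \<alpha> * real n powr (1 - 1 / real CARD('d))) \<longrightarrow>
           (\<forall>\<epsilon>. 0 < \<epsilon> \<and> \<epsilon> \<le> \<epsilon>0 \<longrightarrow>
              ereal (C * (1 / \<epsilon>) powr (real CARD('d) / real r))
              \<le> ereal_of_enat (comp_nonad a b \<eta> (F_class r M D) (mixed_info r k) \<epsilon>))"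
    by blast
qed

end
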